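(* Let $X$ be a real or complex Banach space which has a closed, separable, infinite-dimensional subspace that is complemented in $X$. Then there exists a continuous linear operator $R$ on $X$ such that, putting $$A_R=\{x\in X:\ \|R^t x\|\to\infty \text{ as } t\to\infty\}\quad\text{and}\quad B_R=\{x\in X:\ \liminf_{t\to\infty}\|R^t x-x\|=0\},$$ the following hold. (A) $A_R$ and $B_R$ both have non-empty interior, and $\{A_R,B_R\}$ is a partition of $X$. (B) $R$ can be written $R=I+K$, where $I$ is the identity of $X$ and $K$ is a compact operator on $X$.
   Context: Here $t$ ranges over the non-negative integers, and $R^t$ is the $t$-th iterate of $R$. A closed subspace $X_0$ of $X$ is complemented if there is a closed subspace $Y$ of $X$ with $X=X_0\oplus Y$. *)

theory Defs
  imports "HOL-Analysis.Analysis"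
begin

(* The class banach provides only real scalars.  A Banach space over K (real or complex numbers)
   is rendered as a type of class banach with a K-scalar multiplication that extends scaleR and
   for which the norm of the type is K-homogeneous.  For K = real this forces scale = scaleR. *)
locale normed_space_over = vector_space scale
  for scale :: "'k::real_normed_field \<Rightarrow> 'a::real_normed_vector \<Rightarrow> 'a" +
  assumes norm_scale: "norm (scale c x) = norm c * norm x"
    and scale_of_real: "scale (of_real r) x = r *\<^sub>R x"

lemma normed_space_over_scaleR:
  "normed_space_over (scaleR :: real \<Rightarrow> 'a::real_normed_vector \<Rightarrow> 'a)"
  by unfold_locales (simp_all add: algebra_simps)

lemma normed_space_over_complex: "normed_space_over ((*) :: complex \<Rightarrow> complex \<Rightarrow> complex)"
  by unfold_locales (simp_all add: algebra_simps norm_mult scaleR_conv_of_real)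

definition closed_subspace :: "('k::field \<Rightarrow> 'a::{ab_group_add,topological_space} \<Rightarrow> 'a) \<Rightarrow> 'a set \<Rightarrow> bool"
  where "closed_subspace sc S \<longleftrightarrow> module.subspace sc S \<and> closed S"

definition infinite_dimensional :: "('k::field \<Rightarrow> 'a::ab_group_add \<Rightarrow> 'a) \<Rightarrow> 'a set \<Rightarrow> bool"
  where "infinite_dimensional sc S \<longleftrightarrow> \<not> (\<exists>B. finite B \<and> module.span sc B = S)"

definition complemented :: "('k::field \<Rightarrow> 'a::{ab_group_add,topological_space} \<Rightarrow> 'a) \<Rightarrow> 'a set \<Rightarrow> bool"
  where "complemented sc S \<longleftrightarrow>
    (\<exists>Y. closed_subspace sc Y \<and> S \<inter> Y = {0} \<and> (\<forall>x. \<exists>s\<in>S. \<exists>y\<in>Y. x = s + y))"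

definition continuous_operator :: "('k::field \<Rightarrow> 'a::{ab_group_add,topological_space} \<Rightarrow> 'a) \<Rightarrow> ('a \<Rightarrow> 'a) \<Rightarrow> bool"
  where "continuous_operator sc T \<longleftrightarrow> Vector_Spaces.linear sc sc T \<and> continuous_on UNIV T"

definition compact_operator :: "('k::field \<Rightarrow> 'a::real_normed_vector \<Rightarrow> 'a) \<Rightarrow> ('a \<Rightarrow> 'a) \<Rightarrow> bool"
  where "compact_operator sc T \<longleftrightarrow>
    Vector_Spaces.linear sc sc T \<and> compact (closure (T ` cball 0 1))"

definition A_set :: "('a::real_normed_vector \<Rightarrow> 'a) \<Rightarrow> 'a set"
  where "A_set R = {x. filterlim (\<lambda>t. norm ((R ^^ t) x)) at_top sequentially}"

(* The liminf is taken in the extended reals, where it always exists. *)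
definition B_set :: "('a::real_normed_vector \<Rightarrow> 'a) \<Rightarrow> 'a set"
  where "B_set R = {x. liminf (\<lambda>t. ereal (norm ((R ^^ t) x - x))) = 0}"

end

theory Submission
  imports Defs
begin

text \<open>
  Take a biorthogonal sequence of unit vectors \<open>e n\<close> and functionals \<open>f n\<close> of norm at most 3, and let
  \<open>u = f 0\<close>, \<open>v = f 1\<close>. Group the remaining vectors into planes and let \<open>R\<close> fix every \<open>x\<close> up to a
  rotation of period \<open>N (i + 1)\<close> in the \<open>i\<close>-th plane, whose centre is \<open>h i * (u x - \<mu> i * v x)\<close> times
  a basis vector of the plane. The amplitudes \<open>h i\<close> and the periods, each dividing the next,
  are such that

  \<^item> for \<open>N i / 2 \<le> t \<le> N (i + 1) / 2\<close> the \<open>i\<close>-th plane contributes at least about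
    \<open>g i * \<bar>u x - \<mu> i * v x\<bar>\<close> to the norm of \<open>R\<^sup>t x\<close>, where \<open>g i\<close> tends to infinity;
  \<^item> at time \<open>N i\<close> the planes before the \<open>i\<close>-th one have returned, those after it have hardly
    moved, and the \<open>i\<close>-th one has moved by at most about \<open>g i * \<bar>u x - \<mu> i * v x\<bar>\<close>.

  The \<open>\<mu> i\<close> run through finer and finer nets of the unit ball of the scalar field, slowly enough
  in terms of \<open>g\<close>. So \<open>x\<close> escapes to infinity if \<open>\<bar>v x\<bar> < \<bar>u x\<bar>\<close>, and it is recurrent otherwise.
\<close>

section \<open>Dominated functionals\<close>

definition sublinear :: "('a::real_vector \<Rightarrow> real) \<Rightarrow> bool" where
  "sublinear p \<longleftrightarrow> (\<forall>x y. p (x + y) \<le> p x + p y) \<and> (\<forall>r x. 0 \<le> r \<longrightarrow> p (r *\<^sub>R x) = r * p x)"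

lemma sublinear_add: "sublinear p \<Longrightarrow> p (x + y) \<le> p x + p y"
  and sublinear_scale: "sublinear p \<Longrightarrow> 0 \<le> r \<Longrightarrow> p (r *\<^sub>R x) = r * p x"
  by (auto simp: sublinear_def)

lemma sublinear_zero: "sublinear p \<Longrightarrow> p 0 = 0"
  using sublinear_scale[of p 0 0] by simp

lemma sublinear_minus: "sublinear p \<Longrightarrow> - p (- x) \<le> p x"
  using sublinear_add[of p x "- x"] sublinear_zero[of p] by simp

text \<open>Applied to \<open>inverse r\<close> and \<open>r *\<^sub>R x\<close>, the inequality
  \<open>le\<close> yields its own converse, so one direction of homogeneity is enough.\<close>

lemma sublinearI:
  assumes "\<And>x y. p (x + y) \<le> p x + p y" and "p 0 = 0"
    and le: "\<And>r x. 0 < r \<Longrightarrow> p (r *\<^sub>R x) \<le> r * p x"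
  shows "sublinear p"
proof -
  have "p (r *\<^sub>R x) = r * p x" if "0 \<le> r" for r x
  proof (cases "r = 0")
    case False
    then have "0 < r" using that by simp
    then have "p x \<le> inverse r * p (r *\<^sub>R x)"
      using le[of "inverse r" "r *\<^sub>R x"] by simp
    then have "r * p x \<le> r * (inverse r * p (r *\<^sub>R x))"
      using \<open>0 < r\<close> by (intro mult_left_mono) auto
    then have "r * p x \<le> p (r *\<^sub>R x)" using \<open>0 < r\<close> by (simp add: mult.assoc[symmetric])
    then show ?thesis using le[OF \<open>0 < r\<close>, of x] by simp
  qed (simp add: assms)
  then show ?thesis using assms(1) by (auto simp: sublinear_def)
qed

text \<open>\<open>q' x\<close> is the infimum of \<open>q (x + t y) - t q y\<close> over \<open>t \<ge> 0\<close>; hence a minimal sublinear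
  functional is odd, that is, linear.\<close>

lemma sublinear_decrease:
  assumes q: "sublinear q"
  shows "\<exists>q'. sublinear q' \<and> (\<forall>x. q' x \<le> q x) \<and> q' (- y) \<le> - q y"
proof -
  define g where "g x t = q (x + t *\<^sub>R y) - t * q y" for x and t :: real
  define q' where "q' x = (INF t\<in>{0..}. g x t)" for x
  \<comment> \<open>Splitting \<open>t *\<^sub>R y\<close> as the sum of
    \<open>x + t *\<^sub>R y\<close> and \<open>- x\<close> gives a lower bound free of
    \<open>t\<close>, so the infimum is a genuine one.\<close>
  have lower: "- q (- x) \<le> g x t" if "0 \<le> t" for x t
    using sublinear_add[OF q, of "x + t *\<^sub>R y" "- x"] sublinear_scale[OF q that, of y]
    by (simp add: g_def)
  have bdd: "bdd_below (g x ` {0..})" for x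
    using lower by (auto intro!: bdd_belowI2[where m = "- q (- x)"])
  have le: "q' x \<le> g x t" if "0 \<le> t" for x t
    unfolding q'_def using bdd that by (auto intro!: cINF_lower)
  have ge: "m \<le> q' x" if "\<And>t. 0 \<le> t \<Longrightarrow> m \<le> g x t" for m x
    unfolding q'_def using that by (auto intro!: cINF_greatest)
  have "sublinear q'"
  proof (rule sublinearI)
    fix x z
    \<comment> \<open>The two infima are taken one after the other; the parameters \<open>s\<close>
      and \<open>t\<close> of the summands add up to an admissible parameter for
      \<open>x + z\<close>.\<close>
    have "q' (x + z) - g z t \<le> q' x" if t: "0 \<le> t" for t
    proof (rule ge)
      fix s :: real assume s: "0 \<le> s"
      have "q' (x + z) \<le> g (x + z) (s + t)" using le s t by simp
      also have "\<dots> \<le> g x s + g z t"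
        using sublinear_add[OF q, of "x + s *\<^sub>R y" "z + t *\<^sub>R y"]
        by (simp add: g_def algebra_simps)
      finally show "q' (x + z) - g z t \<le> g x s" by simp
    qed
    then have "q' (x + z) - q' x \<le> q' z" by (intro ge) (simp add: algebra_simps)
    then show "q' (x + z) \<le> q' x + q' z" by simp
  next
    have "q' 0 \<le> 0" using le[of 0 0] by (simp add: g_def sublinear_zero[OF q])
    moreover have "0 \<le> q' 0" using ge[of 0 0] lower[of _ 0] by (simp add: sublinear_zero[OF q])
    ultimately show "q' 0 = 0" by simp
  next
    fix r :: real and x assume r: "0 < r"
    have "q' (r *\<^sub>R x) / r \<le> q' x"
    proof (rule ge)
      fix t :: real assume t: "0 \<le> t"
      have "q' (r *\<^sub>R x) \<le> g (r *\<^sub>R x) (r * t)" using le r t by simp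
      also have "\<dots> = r * g x t"
        using sublinear_scale[OF q, of r "x + t *\<^sub>R y"] r by (simp add: g_def algebra_simps)
      finally show "q' (r *\<^sub>R x) / r \<le> g x t" using r by (simp add: field_simps)
    qed
    then show "q' (r *\<^sub>R x) \<le> r * q' x" using r by (simp add: field_simps)
  qed
  moreover have "q' x \<le> q x" for x using le[of 0 x] by (simp add: g_def)
  moreover have "q' (- y) \<le> - q y" using le[of 1 "- y"] by (simp add: g_def sublinear_zero[OF q])
  ultimately show ?thesis by blast
qed

text \<open>Zorn's lemma for the reversed pointwise order: a nonempty chain has its pointwise
  infimum as upper bound, which is finite because every member stays above
  \<open>- p (- x)\<close>.\<close>

lemma minimal_sublinear_exists:
  assumes p: "sublinear p"
  shows "\<exists>q. sublinear q \<and> (\<forall>x. q x \<le> p x) \<and>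
    (\<forall>q'. sublinear q' \<and> (\<forall>x. q' x \<le> q x) \<longrightarrow> q' = q)"
proof -
  define S where "S = {q. sublinear q \<and> (\<forall>x. q x \<le> p x)}"
  define P where "P q q' \<longleftrightarrow> (\<forall>x. q' x \<le> q x)" for q q' :: "'a \<Rightarrow> real"
  have po: "partial_order_on S (relation_of P S)"
    by (rule partial_order_on_relation_ofI) (auto simp: P_def fun_eq_iff intro: order_trans antisym)
  have "\<exists>u\<in>S. \<forall>q\<in>C. P q u" if C: "C \<in> Chains (relation_of P S)" for C
  proof (cases "C = {}")
    case True
    then show ?thesis using p by (auto simp: S_def)
  next
    case False
    have CS: "C \<subseteq> S" and tot: "\<And>q q'. q \<in> C \<Longrightarrow> q' \<in> C \<Longrightarrow> P q q' \<or> P q' q"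
      using C by (auto simp: Chains_def relation_of_def)
    define u where "u x = (INF q\<in>C. q x)" for x
    have lower: "- p (- x) \<le> q x" if "q \<in> C" for q x
    proof -
      have "q (- x) \<le> p (- x)" "- q (- x) \<le> q x"
        using that CS by (auto simp: S_def intro: sublinear_minus)
      then show ?thesis by simp
    qed
    have le: "u x \<le> q x" if "q \<in> C" for x q
      unfolding u_def using that lower
      by (auto intro!: cINF_lower bdd_belowI2[where m = "- p (- x)"])
    have ge: "m \<le> u x" if "\<And>q. q \<in> C \<Longrightarrow> m \<le> q x" for m x
      unfolding u_def using that False by (auto intro!: cINF_greatest)
    have sub: "sublinear q" if "q \<in> C" for q using that CS by (auto simp: S_def)
    have "sublinear u"
    proof (rule sublinearI)
      fix x z
      have "u (x + z) - q2 z \<le> u x" if q2: "q2 \<in> C" for q2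
      proof (rule ge)
        fix q1 assume q1: "q1 \<in> C"
        \<comment> \<open>Here the chain condition enters: one of \<open>q1\<close>,
          \<open>q2\<close> lies below both. For an arbitrary family the infimum need not be
          subadditive.\<close>
        obtain q where q: "q \<in> C" "q x \<le> q1 x" "q z \<le> q2 z"
          using tot[OF q1 q2] q1 q2 by (auto simp: P_def)
        then show "u (x + z) - q2 z \<le> q1 x"
          using le[OF q(1), of "x + z"] sublinear_add[OF sub[OF q(1)], of x z] by simp
      qed
      then have "u (x + z) - u x \<le> u z" by (intro ge) (simp add: algebra_simps)
      then show "u (x + z) \<le> u x + u z" by simp
    next
      obtain q where "q \<in> C" using False by blast
      then have "u 0 \<le> 0" using le[of q 0] sublinear_zero[OF sub[of q]] by simp
      moreover have "0 \<le> u 0" by (intro ge) (metis order_refl sub sublinear_zero)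
      ultimately show "u 0 = 0" by simp
    next
      fix r :: real and x assume r: "0 < r"
      have "u (r *\<^sub>R x) / r \<le> u x"
      proof (rule ge)
        fix q assume "q \<in> C"
        then show "u (r *\<^sub>R x) / r \<le> q x"
          using le[of q "r *\<^sub>R x"] sublinear_scale[OF sub, of q r x] r
          by (simp add: field_simps)
      qed
      then show "u (r *\<^sub>R x) \<le> r * u x" using r by (simp add: field_simps)
    qed
    moreover obtain q where "q \<in> C" using False by blast
    moreover have "u x \<le> p x" for x
      using le[OF \<open>q \<in> C\<close>, of x] \<open>q \<in> C\<close> CS by (force simp: S_def intro: order_trans)
    ultimately show ?thesis using le by (auto simp: S_def P_def)
  qed
  from predicate_Zorn[OF po this] obtain q where "q \<in> S" "\<And>q'. q' \<in> S \<Longrightarrow> P q q' \<Longrightarrow> q' = q"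
    by blast
  then have "\<forall>q'. sublinear q' \<and> (\<forall>x. q' x \<le> q x) \<longrightarrow> q' = q"
    unfolding S_def P_def mem_Collect_eq by (meson order_trans)
  then show ?thesis using \<open>q \<in> S\<close> by (auto simp: S_def)
qed

text \<open>Before minimising, \<open>p\<close> is lowered to \<open>p'\<close> with
  \<open>p' (- x0) \<le> - p x0\<close>. A minimal \<open>q\<close> below \<open>p'\<close> is odd
  by \<open>sublinear_decrease\<close>, hence linear, and oddness turns the bound at
  \<open>- x0\<close> into \<open>q x0 \<ge> p x0\<close>.\<close>

theorem hahn_banach_dominated:
  fixes p :: "'a::real_vector \<Rightarrow> real"
  assumes p: "sublinear p"
  shows "\<exists>f. linear f \<and> (\<forall>x. f x \<le> p x) \<and> f x0 = p x0"
proof -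
  obtain p' where p': "sublinear p'" "\<And>x. p' x \<le> p x" "p' (- x0) \<le> - p x0"
    using sublinear_decrease[OF p] by blast
  obtain q where q: "sublinear q" "\<And>x. q x \<le> p' x"
    and min: "\<And>q'. sublinear q' \<Longrightarrow> (\<And>x. q' x \<le> q x) \<Longrightarrow> q' = q"
    using minimal_sublinear_exists[OF p'(1)] by blast
  have "q (- y) \<le> - q y" for y
    using sublinear_decrease[OF q(1), of y] min by metis
  then have odd: "q (- y) = - q y" for y
    using sublinear_minus[OF q(1), of y] by (metis minus_le_iff order_antisym)
  have "q (x + y) = q x + q y" for x y
    using sublinear_add[OF q(1), of x y] sublinear_add[OF q(1), of "x + y" "- y"] odd[of y] by simp
  moreover have "q (r *\<^sub>R x) = r * q x" for r x
    using sublinear_scale[OF q(1), of r x] sublinear_scale[OF q(1), of "- r" x] odd[of "r *\<^sub>R x"]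
    by (cases "0 \<le> r") auto
  ultimately have "linear q" by (intro linearI) auto
  moreover have "q x0 = p x0"
    using q(2)[of x0] p'(2)[of x0] q(2)[of "- x0"] p'(3) odd[of x0] by linarith
  moreover have "q x \<le> p x" for x using q(2) p'(2) order_trans by blast
  ultimately show ?thesis by blast
qed

section \<open>Bounded biorthogonal sequences\<close>

context normed_space_over
begin

definition seminorm :: "('a \<Rightarrow> real) \<Rightarrow> bool" where
  "seminorm p \<longleftrightarrow> (\<forall>x y. p (x + y) \<le> p x + p y) \<and> (\<forall>c x. p (scale c x) = norm c * p x)"

definition functional :: "('a \<Rightarrow> 'k) \<Rightarrow> bool" where
  "functional f \<longleftrightarrow> (\<forall>x y. f (x + y) = f x + f y) \<and> (\<forall>c x. f (scale c x) = c * f x)"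

lemma functional_add: "functional f \<Longrightarrow> f (x + y) = f x + f y"
  and functional_scale: "functional f \<Longrightarrow> f (scale c x) = c * f x"
  by (auto simp: functional_def)

lemma functional_scaleR: "functional f \<Longrightarrow> f (r *\<^sub>R x) = r *\<^sub>R f x"
  using functional_scale[of f "of_real r" x] by (simp add: scale_of_real scaleR_conv_of_real)

lemma functional_linear: "functional f \<Longrightarrow> linear f"
  by (intro linearI functional_add functional_scaleR)

lemma functional_zero: "functional f \<Longrightarrow> f 0 = 0"
  and functional_diff: "functional f \<Longrightarrow> f (x - y) = f x - f y"
  using functional_linear by (auto intro: linear_0 linear_diff)

lemma functional_bounded_linear:
  assumes "functional f" and "\<And>x. norm (f x) \<le> norm x * M"
  shows "bounded_linear f"
  using functional_add[OF assms(1)] functional_scaleR[OF assms(1)] assms(2)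
  by (rule bounded_linear_intro)

lemma bounded_linear_scale_left: "bounded_linear (\<lambda>c. scale c x)"
proof (rule bounded_linear_intro[where K = "norm x"])
  show "scale (r *\<^sub>R c) x = r *\<^sub>R scale c x" for r c
    by (simp add: scaleR_conv_of_real flip: scale_scale scale_of_real)
qed (simp_all add: scale_left_distrib norm_scale)

lemma bounded_linear_scale_right: "bounded_linear (scale c)"
proof (rule bounded_linear_intro[where K = "norm c"])
  show "scale c (r *\<^sub>R x) = r *\<^sub>R scale c x" for r x
    by (simp add: mult.commute flip: scale_of_real)
qed (simp_all add: scale_right_distrib norm_scale mult.commute)

lemma seminorm_norm: "seminorm norm"
  by (simp add: seminorm_def norm_triangle_ineq norm_scale)

text \<open>This is the quotient norm modulo \<open>E\<close>. Any functional dominated by it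
  vanishes on \<open>E\<close>, which is how annihilating functionals are produced below.\<close>

lemma seminorm_infdist:
  assumes E: "subspace E"
  shows "seminorm (\<lambda>x. infdist x E)"
proof -
  have ne: "E \<noteq> {}" using subspace_0[OF E] by blast
  have approx: "\<exists>y\<in>E. dist x y < infdist x E + e" if "0 < e" for x and e :: real
    using cINF_less_iff[of E "dist x" "infdist x E + e"] that ne infdist_notempty[OF ne, of x]
    by auto
  have add: "infdist (x + y) E \<le> infdist x E + infdist y E" for x y
  proof (rule field_le_epsilon)
    fix e :: real assume "0 < e"
    then have "0 < e / 2" by simp
    then obtain u v where uv: "u \<in> E" "v \<in> E" "dist x u < infdist x E + e/2" "dist y v < infdist y E + e/2"
      using approx by meson
    have "infdist (x + y) E \<le> dist (x + y) (u + v)"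
      using uv E by (intro infdist_le) (auto simp: subspace_def)
    also have "\<dots> \<le> dist x u + dist y v" by (rule dist_triangle_add)
    finally show "infdist (x + y) E \<le> infdist x E + infdist y E + e" using uv by simp
  qed
  have le: "infdist (scale c x) E \<le> norm c * infdist x E" for c x
  proof (rule field_le_epsilon)
    fix e :: real assume "0 < e"
    \<comment> \<open>Adding 1 keeps the denominator positive when \<open>c = 0\<close>, and
      multiplying by \<open>norm c\<close> still leaves an error of at most
      \<open>e\<close>.\<close>
    then have "0 < e / (norm c + 1)" by (simp add: add_nonneg_pos)
    then obtain u where u: "u \<in> E" "dist x u < infdist x E + e / (norm c + 1)"
      using approx by blast
    have "infdist (scale c x) E \<le> dist (scale c x) (scale c u)"
      using u E by (intro infdist_le) (auto simp: subspace_def)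
    also have "\<dots> = norm c * dist x u"
      by (simp add: dist_norm norm_scale flip: scale_right_diff_distrib)
    also have "\<dots> \<le> norm c * (infdist x E + e / (norm c + 1))"
      using u(2) by (intro mult_left_mono) auto
    also have "\<dots> = norm c * infdist x E + e * (norm c / (norm c + 1))" by (simp add: algebra_simps)
    also have "\<dots> \<le> norm c * infdist x E + e * 1"
      using \<open>0 < e\<close> by (intro add_left_mono mult_left_mono) (auto simp: divide_le_eq add_nonneg_pos)
    finally show "infdist (scale c x) E \<le> norm c * infdist x E + e" by simp
  qed
  have "infdist (scale c x) E = norm c * infdist x E" for c x
  proof (cases "c = 0")
    case True
    then show ?thesis using E by (simp add: subspace_0 infdist_zero)
  next
    case False
    have "infdist x E \<le> norm (inverse c) * infdist (scale c x) E"
      using le[of "inverse c" "scale c x"] False by simp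
    then have "norm c * infdist x E \<le> infdist (scale c x) E"
      using False by (simp add: norm_inverse norm_divide field_simps)
    then show ?thesis using le[of c x] by simp
  qed
  with add show ?thesis by (simp add: seminorm_def)
qed

text \<open>The kernel has codimension at most one in \<open>W\<close>: a finite spanning set of it,
  enlarged by one vector \<open>w\<close> with \<open>f w \<noteq> 0\<close>, would span
  \<open>W\<close>.\<close>

lemma infinite_dimensional_kernel:
  assumes W: "subspace W" "infinite_dimensional scale W" and f: "functional f"
  shows "subspace {x \<in> W. f x = 0}" and "infinite_dimensional scale {x \<in> W. f x = 0}"
proof -
  show sub: "subspace {x \<in> W. f x = 0}"
    using W(1) by (auto simp: subspace_def functional_add[OF f] functional_scale[OF f] functional_zero[OF f])
  show "infinite_dimensional scale {x \<in> W. f x = 0}"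
    unfolding infinite_dimensional_def
  proof
    assume "\<exists>B. finite B \<and> span B = {x \<in> W. f x = 0}"
    then obtain B where B: "finite B" "span B = {x \<in> W. f x = 0}" by blast
    show False
    proof (cases "\<forall>x\<in>W. f x = 0")
      case True
      then have "span B = W" using B(2) by auto
      then show False using W(2) B(1) by (auto simp: infinite_dimensional_def)
    next
      case False
      then obtain w where w: "w \<in> W" "f w \<noteq> 0" by blast
      have "insert w B \<subseteq> W" using w B(2) span_superset[of B] by auto
      then have "span (insert w B) \<subseteq> W" using W(1) by (rule span_minimal)
      moreover have "x \<in> span (insert w B)" if x: "x \<in> W" for x
      proof -
        have "x - scale (f x / f w) w \<in> span B"
          using x w W(1) by (auto simp: B(2) functional_diff[OF f] functional_scale[OF f]
              intro!: subspace_diff subspace_scale)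
        then show ?thesis using span_breakdown_eq by blast
      qed
      ultimately have "span (insert w B) = W" by blast
      then show False using W(2) B(1) by (auto simp: infinite_dimensional_def)
    qed
  qed
qed

lemma common_kernel_vector:
  assumes "finite F" and "subspace V" and "infinite_dimensional scale V"
    and "\<And>f. f \<in> F \<Longrightarrow> functional f"
  shows "\<exists>e\<in>V. norm e = 1 \<and> (\<forall>f\<in>F. f e = 0)"
proof -
  have "subspace {x \<in> V. \<forall>f\<in>F. f x = 0} \<and> infinite_dimensional scale {x \<in> V. \<forall>f\<in>F. f x = 0}"
    using assms(1,4)
  proof (induction F rule: finite_induct)
    case empty
    then show ?case using assms by simp
  next
    case (insert f F)
    have "{x \<in> V. \<forall>g\<in>insert f F. g x = 0} = {x \<in> {x \<in> V. \<forall>g\<in>F. g x = 0}. f x = 0}" by auto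
    then show ?case using insert infinite_dimensional_kernel[of "{x \<in> V. \<forall>g\<in>F. g x = 0}" f] by simp
  qed
  then have W: "subspace {x \<in> V. \<forall>f\<in>F. f x = 0}" "infinite_dimensional scale {x \<in> V. \<forall>f\<in>F. f x = 0}"
    by auto
  have "{x \<in> V. \<forall>f\<in>F. f x = 0} \<noteq> {0}"
    using W(2) span_empty unfolding infinite_dimensional_def by (metis finite.emptyI)
  then obtain x where x: "x \<in> V" "\<forall>f\<in>F. f x = 0" "x \<noteq> 0"
    using subspace_0[OF W(1)] by blast
  define e where "e = scale (of_real (inverse (norm x))) x"
  have "e \<in> V" using x assms(2) by (auto simp: e_def intro: subspace_scale)
  moreover have "norm e = 1" using x by (simp add: e_def norm_scale norm_inverse)
  moreover have "\<forall>f\<in>F. f e = 0" using x assms(4) by (simp add: e_def functional_scale)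
  ultimately show ?thesis by blast
qed

end

text \<open>Extension is assumed here so that the construction runs once for both scalar fields; the
  assumption is discharged separately for real and for complex scalars.\<close>

locale hahn_banach_space = normed_space_over scale
  for scale :: "'k::{real_normed_field,heine_borel} \<Rightarrow> 'v::banach \<Rightarrow> 'v" +
  assumes extension: "seminorm p \<Longrightarrow>
    \<exists>f. functional f \<and> (\<forall>x. norm (f x) \<le> p x) \<and> norm (f x0) = p x0"
begin

text \<open>Replaces compactness of the unit sphere of a finite-dimensional span: the sphere lies in
  such a box, and a finite net of the box serves equally well.\<close>

lemma compact_coefficient_box:
  fixes n :: nat
  shows "compact {\<Sum>i<n. scale (c i) (e i) | c. \<forall>i<n. norm (c i) \<le> (r i :: real)}"
proof (induction n)
  case 0
  then show ?case by simp
next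
  case (Suc n)
  let ?S = "{\<Sum>i<n. scale (c i) (e i) | c. \<forall>i<n. norm (c i) \<le> r i}"
  let ?T = "(\<lambda>d. scale d (e n)) ` cball 0 (r n)"
  have "compact ?T"
    by (intro compact_continuous_image linear_continuous_on bounded_linear_scale_left compact_cball)
  moreover have "{\<Sum>i<Suc n. scale (c i) (e i) | c. \<forall>i<Suc n. norm (c i) \<le> r i}
      = {x + y |x y. x \<in> ?S \<and> y \<in> ?T}" (is "?L = ?R")
  proof (intro equalityI subsetI)
    fix z assume "z \<in> ?L"
    then show "z \<in> ?R" by (fastforce simp: less_Suc_eq)
  next
    fix z assume "z \<in> ?R"
    then obtain c d where c: "\<forall>i<n. norm (c i) \<le> r i" "norm d \<le> r n"
      "z = (\<Sum>i<n. scale (c i) (e i)) + scale d (e n)" by auto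
    have "z = (\<Sum>i<Suc n. scale ((c(n := d)) i) (e i))" using c(3) by simp
    moreover have "\<forall>i<Suc n. norm ((c(n := d)) i) \<le> r i" using c by (auto simp: less_Suc_eq)
    ultimately show "z \<in> ?L" by blast
  qed
  ultimately show ?case using compact_sums[OF Suc] by simp
qed

text \<open>Mazur's construction of basic sequences: a vector annihilated by finitely many functionals
  that almost norm the unit sphere of a finite-dimensional subspace stays far from that subspace.\<close>

lemma biorthogonal_step:
  fixes e :: "nat \<Rightarrow> 'v" and f :: "nat \<Rightarrow> 'v \<Rightarrow> 'k"
  assumes V: "subspace V" "infinite_dimensional scale V"
    and f: "\<And>i. i < n \<Longrightarrow> functional (f i)" "\<And>i x. i < n \<Longrightarrow> norm (f i x) \<le> 3 * norm x"
    and biorth: "\<And>i j. i < n \<Longrightarrow> j < n \<Longrightarrow> f i (e j) = (if i = j then 1 else 0)"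
  shows "\<exists>v g. v \<in> V \<and> norm v = 1 \<and> functional g \<and> (\<forall>x. norm (g x) \<le> 3 * norm x) \<and> g v = 1 \<and>
    (\<forall>i<n. g (e i) = 0 \<and> f i v = 0)"
proof -
  define E where "E = span (e ` {..<n})"
  have E: "subspace E" by (simp add: E_def)
  \<comment> \<open>The bound 3 on the functionals \<open>f i\<close> bounds the coordinates of a
    unit vector of \<open>E\<close>, so \<open>D\<close> contains the unit sphere of
    \<open>E\<close>.\<close>
  define D where "D = {\<Sum>i<n. scale (c i) (e i) | c. \<forall>i<n. norm (c i) \<le> (3::real)}"
  have "compact D" unfolding D_def by (rule compact_coefficient_box)
  then obtain k where k: "finite k" "D \<subseteq> (\<Union>x\<in>k. ball x (1/4))"
    unfolding compact_eq_totally_bounded by (meson zero_less_divide_1_iff zero_less_numeral)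
  have expand: "y = (\<Sum>i<n. scale (f i y) (e i))" if "y \<in> E" for y
    using that unfolding E_def
  proof (induction rule: span_induct_alt)
    case base
    then show ?case by (simp add: functional_zero f(1))
  next
    case (step c x y)
    then obtain j where j: "j < n" "x = e j" by auto
    have "(\<Sum>i<n. scale (f i (scale c x + y)) (e i))
        = (\<Sum>i<n. scale (if i = j then c else 0) (e i) + scale (f i y) (e i))"
      using j by (intro sum.cong) (auto simp: functional_add functional_scale f(1) biorth scale_left_distrib)
    also have "\<dots> = scale c (e j) + (\<Sum>i<n. scale (f i y) (e i))"
      using j by (simp add: sum.distrib if_distrib[of "\<lambda>c. scale c _"] cong: if_cong)
    finally show ?case using step j by simp
  qed
  have unitD: "y \<in> D" if "y \<in> E" "norm y = 1" for y
    unfolding D_def using expand[OF that(1)] f(2)[of _ y] that(2) by auto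
  have "\<forall>x. \<exists>\<psi>. functional \<psi> \<and> (\<forall>y. norm (\<psi> y) \<le> norm y) \<and> norm (\<psi> x) = norm x"
    using extension[OF seminorm_norm] by blast
  then obtain \<psi> where \<psi>: "\<And>x. functional (\<psi> x)" "\<And>x y. norm (\<psi> x y) \<le> norm y"
      "\<And>x. norm (\<psi> x x) = norm x" by metis
  have "\<exists>v\<in>V. norm v = 1 \<and> (\<forall>g\<in>\<psi> ` k \<union> f ` {..<n}. g v = 0)"
    by (rule common_kernel_vector) (use k V \<psi> f in auto)
  then obtain v where v: "v \<in> V" "norm v = 1" "\<And>x. x \<in> k \<Longrightarrow> \<psi> x v = 0" "\<And>i. i < n \<Longrightarrow> f i v = 0"
    by auto
  \<comment> \<open>A net point \<open>x\<close> within 1/4 of \<open>y\<close> has norm at least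
    3/4, and \<open>\<psi> x\<close> loses at most another 1/4 in passing from \<open>x\<close> to
    \<open>y\<close>. Since \<open>\<psi> x\<close> kills \<open>v\<close>, the value 1/2 survives
    the addition of any multiple of \<open>v\<close>.\<close>
  have unit_far: "1/2 \<le> norm (y + scale c v)" if y: "y \<in> E" "norm y = 1" for y c
  proof -
    obtain x where x: "x \<in> k" "dist x y < 1/4" using unitD[OF y] k(2) by auto
    have "norm (\<psi> x (y + scale c v)) = norm (\<psi> x y)"
      by (simp add: functional_add[OF \<psi>(1)] functional_scale[OF \<psi>(1)] v(3)[OF x(1)])
    moreover have "norm (\<psi> x x) \<le> norm (\<psi> x y) + norm (\<psi> x (x - y))"
      unfolding functional_diff[OF \<psi>(1)] by (rule norm_triangle_sub)
    moreover have "norm (\<psi> x (x - y)) \<le> dist x y" using \<psi>(2) by (simp add: dist_norm)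
    moreover have "norm y \<le> norm x + dist x y"
      using norm_triangle_sub[of y x] by (simp add: dist_norm norm_minus_commute)
    ultimately show ?thesis using \<psi>(2)[of x "y + scale c v"] \<psi>(3)[of x] x(2) y(2) by linarith
  qed
  have far: "norm y \<le> 2 * norm (y + scale c v)" if y: "y \<in> E" for y c
  proof (cases "y = 0")
    case False
    define r where "r = inverse (norm y)"
    have r: "0 < r" "norm (scale (of_real r) y) = 1"
      using False by (simp_all add: r_def norm_scale norm_inverse)
    have "1/2 \<le> norm (scale (of_real r) y + scale (of_real r * c) v)"
      using r y E by (intro unit_far) (auto intro: subspace_scale)
    also have "\<dots> = r * norm (y + scale c v)"
      using r(1) by (simp add: norm_scale flip: scale_scale scale_right_distrib)
    finally show ?thesis using False by (simp add: r_def field_simps)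
  qed simp
  \<comment> \<open>From \<open>norm y \<le> 2 * norm (v - y)\<close> and \<open>norm v = 1\<close>
    one gets \<open>1 \<le> 3 * norm (v - y)\<close>. This is the origin of the uniform constant 3,
    which does not deteriorate with \<open>n\<close>.\<close>
  have "1/3 \<le> norm (v - y)" if y: "y \<in> E" for y
    using far[OF y, of "-1"] norm_triangle_sub[of v y] v(2) by (simp add: norm_minus_commute)
  then have d: "1/3 \<le> infdist v E"
    using subspace_0[OF E] unfolding infdist_def
    by (simp add: dist_norm del: divide_const_simps) (blast intro: cINF_greatest)
  obtain g where g: "functional g" "\<And>x. norm (g x) \<le> infdist x E" "norm (g v) = infdist v E"
    using extension[OF seminorm_infdist[OF E], of v] by blast
  have gv: "1/3 \<le> norm (g v)" "g v \<noteq> 0" using g(3) d by auto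
  define h where "h x = g x / g v" for x
  have "functional h" using g(1) by (auto simp: functional_def h_def add_divide_distrib)
  moreover have "norm (h x) \<le> 3 * norm x" for x
  proof -
    have "infdist x E \<le> norm x" using infdist_le[OF subspace_0[OF E], of x] by simp
    then have "norm (g x) \<le> norm x" using g(2)[of x] by simp
    then have "norm (h x) \<le> norm x / norm (g v)" using gv by (simp add: h_def norm_divide divide_right_mono)
    also have "\<dots> \<le> norm x / (1/3)" using gv by (intro divide_left_mono) auto
    finally show ?thesis by simp
  qed
  moreover have "h v = 1" using gv by (simp add: h_def)
  moreover have "h (e i) = 0" if "i < n" for i
  proof -
    have "e i \<in> E" using that by (auto simp: E_def intro: span_base)
    then show ?thesis using g(2)[of "e i"] infdist_zero[of "e i" E] by (simp add: h_def)
  qed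
  ultimately show ?thesis using v by blast
qed

theorem bounded_biorthogonal_sequence:
  assumes "subspace V" and "infinite_dimensional scale V"
  shows "\<exists>(e :: nat \<Rightarrow> 'v) f. (\<forall>n. e n \<in> V \<and> norm (e n) = 1 \<and> functional (f n) \<and> (\<forall>x. norm (f n x) \<le> 3 * norm x)) \<and>
    (\<forall>i j. f i (e j) = (if i = j then 1 else 0))"
proof -
  \<comment> \<open>A pair \<open>r\<close> may follow the pairs \<open>s i\<close> with
    \<open>i < n\<close> if biorthogonality holds in both directions: the new functional kills the
    old vectors and the old functionals kill the new vector.\<close>
  define P where "P s n r \<longleftrightarrow> fst r \<in> V \<and> norm (fst r) = 1 \<and> functional (snd r) \<and>
      (\<forall>x. norm (snd r x) \<le> 3 * norm x) \<and> snd r (fst r) = 1 \<and>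
      (\<forall>i<n. snd r (fst (s i)) = 0 \<and> snd (s i) (fst r) = 0)"
    for s :: "nat \<Rightarrow> 'v \<times> ('v \<Rightarrow> 'k)" and n :: nat and r
  have "\<exists>s. \<forall>n. P s n (s n)"
  proof (rule dependent_wellorder_choice)
    fix r :: "'v \<times> ('v \<Rightarrow> 'k)" and s t :: "nat \<Rightarrow> 'v \<times> ('v \<Rightarrow> 'k)" and n
    assume "\<And>i. i < n \<Longrightarrow> s i = t i"
    then show "P s n r = P t n r" by (simp add: P_def cong: imp_cong)
  next
    fix n and s :: "nat \<Rightarrow> 'v \<times> ('v \<Rightarrow> 'k)"
    assume s: "\<And>i. i < n \<Longrightarrow> P s i (s i)"
    have "snd (s i) (fst (s j)) = (if i = j then 1 else 0)" if "i < n" "j < n" for i j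
      using s[OF that(1)] s[OF that(2)] by (cases i j rule: linorder_cases) (auto simp: P_def)
    then have "\<exists>v g. v \<in> V \<and> norm v = 1 \<and> functional g \<and> (\<forall>x. norm (g x) \<le> 3 * norm x) \<and> g v = 1 \<and>
        (\<forall>i<n. g (fst (s i)) = 0 \<and> snd (s i) v = 0)"
      using s by (intro biorthogonal_step assms) (auto simp: P_def)
    then show "\<exists>r. P s n r" by (simp add: P_def)
  qed
  then obtain s where s: "\<And>n. P s n (s n)" by blast
  have "snd (s i) (fst (s j)) = (if i = j then 1 else 0)" for i j
    using s[of i] s[of j] by (cases i j rule: linorder_cases) (auto simp: P_def)
  then show ?thesis using s unfolding P_def
    by - (rule exI[of _ "fst \<circ> s"], rule exI[of _ "snd \<circ> s"], simp)
qed

end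

section \<open>Dominated extension for real and for complex scalars\<close>

lemma hahn_banach_space_real: "hahn_banach_space (scaleR :: real \<Rightarrow> 'a::banach \<Rightarrow> 'a)"
proof -
  interpret normed_space_over "scaleR :: real \<Rightarrow> 'a \<Rightarrow> 'a" by (rule normed_space_over_scaleR)
  show ?thesis
  proof unfold_locales
    fix p :: "'a \<Rightarrow> real" and x0 :: 'a
    assume p: "seminorm p"
    then have "sublinear p" by (simp add: seminorm_def sublinear_def)
    then obtain f where f: "linear f" "\<And>x. f x \<le> p x" "f x0 = p x0"
      using hahn_banach_dominated by blast
    have "p (- x) = p x" for x using p by (simp add: seminorm_def) (metis abs_minus_cancel abs_one mult_1 scaleR_minus1_left)
    then have bound: "\<bar>f x\<bar> \<le> p x" for x using f(2)[of x] f(2)[of "- x"] linear_neg[OF f(1), of x] by simp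
    moreover have "functional f" using f(1) by (simp add: functional_def linear_add linear_cmul)
    moreover have "0 \<le> p x0" using bound[of x0] by simp
    ultimately show "\<exists>f. functional f \<and> (\<forall>x. norm (f x) \<le> p x) \<and> norm (f x0) = p x0"
      using f(3) by auto
  qed
qed

lemma hahn_banach_space_complex:
  fixes scaleC :: "complex \<Rightarrow> 'a::banach \<Rightarrow> 'a"
  assumes "normed_space_over scaleC"
  shows "hahn_banach_space scaleC"
proof -
  interpret normed_space_over scaleC by fact
  show ?thesis
  proof unfold_locales
    fix p :: "'a \<Rightarrow> real" and x0 :: 'a
    assume p: "seminorm p"
    have pC: "p (scaleC c x) = norm c * p x" for c x using p by (simp add: seminorm_def)
    have "p (r *\<^sub>R x) = \<bar>r\<bar> * p x" for r x using pC[of "of_real r" x] unfolding scale_of_real by simp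
    then have "sublinear p" using p by (simp add: seminorm_def sublinear_def)
    then obtain f where f: "linear f" "\<And>x. f x \<le> p x" "f x0 = p x0"
      using hahn_banach_dominated by blast
    \<comment> \<open>The complex functional with real part \<open>f\<close>: complex linearity
      forces the imaginary part to be \<open>- f (scaleC \<i> x)\<close>.\<close>
    define F where "F x = Complex (f x) (- f (scaleC \<i> x))" for x
    have scale_split: "scaleC c x = Re c *\<^sub>R x + Im c *\<^sub>R scaleC \<i> x" for c x
    proof -
      have "scaleC c x = scaleC (of_real (Re c) + of_real (Im c) * \<i>) x"
        by (simp add: complex_eq mult.commute flip: complex_eq)
      then show ?thesis by (simp add: scale_left_distrib flip: scale_scale scale_of_real)
    qed
    have ii: "scaleC \<i> (scaleC \<i> x) = - x" for x using scale_minus_left[of 1 x] by simp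
    have scaleR_comm: "scaleC \<i> (r *\<^sub>R x) = r *\<^sub>R scaleC \<i> x" for r x
      by (simp add: mult.commute flip: scale_of_real)
    have F: "functional F"
      unfolding functional_def
    proof (intro conjI allI)
      show "F (x + y) = F x + F y" for x y
        by (simp add: F_def scale_right_distrib linear_add[OF f(1)] complex_eq_iff)
      show "F (scaleC c x) = c * F x" for c x
      proof -
        have "f (scaleC c x) = Re c * f x + Im c * f (scaleC \<i> x)"
          by (subst scale_split) (simp add: linear_add[OF f(1)] linear_cmul[OF f(1)])
        moreover have "f (scaleC \<i> (scaleC c x)) = Re c * f (scaleC \<i> x) - Im c * f x"
          by (subst scale_split[of c])
            (simp add: scale_right_distrib scaleR_comm ii linear_add[OF f(1)] linear_diff[OF f(1)] linear_neg[OF f(1)] linear_cmul[OF f(1)] del: scale_scale)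
        ultimately show ?thesis by (simp add: F_def complex_eq_iff algebra_simps)
      qed
    qed
    have bound: "norm (F x) \<le> p x" for x
    proof -
      \<comment> \<open>Rotating \<open>x\<close> by \<open>c\<close> makes \<open>F\<close> real
        and nonnegative there, so its modulus is a value of \<open>f\<close> and is dominated by
        \<open>p\<close>.\<close>
      define c where "c = cnj (sgn (F x))"
      have "c * F x = (F x * cnj (F x)) / of_real (norm (F x))" by (simp add: c_def sgn_eq)
      also have "\<dots> = of_real (norm (F x))"
        unfolding complex_norm_square[symmetric] by (simp add: power2_eq_square)
      finally have "c * F x = of_real (norm (F x))" .
      then have "F (scaleC c x) = of_real (norm (F x))" using functional_scale[OF F] by simp
      then have "norm (F x) = f (scaleC c x)" by (simp add: F_def complex_eq_iff)
      also have "\<dots> \<le> norm c * p x" using f(2) pC by metis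
      \<comment> \<open>If \<open>F x = 0\<close> then \<open>c = 0\<close>, and the claim becomes
        nonnegativity of \<open>p x\<close>; otherwise \<open>c\<close> is unimodular.\<close>
      also have "\<dots> \<le> p x"
      proof (cases "F x = 0")
        case True
        have "p x = p (- x)" using pC[of "-1" x] by simp
        then have "0 \<le> p x" using f(2)[of x] f(2)[of "- x"] linear_neg[OF f(1), of x] by linarith
        then show ?thesis using True by (simp add: c_def)
      qed (simp add: c_def norm_sgn)
      finally show ?thesis .
    qed
    moreover have "norm (F x0) = p x0"
      using bound[of x0] abs_Re_le_cmod[of "F x0"] f(3) by (simp add: F_def)
    ultimately show "\<exists>f. functional f \<and> (\<forall>x. norm (f x) \<le> p x) \<and> norm (f x0) = p x0"
      using F by blast
  qed
qed

section \<open>Rotations of countably many planes\<close>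

lemma compact_closure_approximation:
  fixes S :: "'a::{metric_space} set"
  assumes "complete (UNIV :: 'a set)"
    and approx: "\<And>r. 0 < r \<Longrightarrow> \<exists>C. compact C \<and> (\<forall>x\<in>S. \<exists>y\<in>C. dist y x < r)"
  shows "compact (closure S)"
  unfolding compact_eq_totally_bounded
proof (intro conjI allI impI)
  show "complete (closure S)"
    using complete_closed_subset[OF closed_closure subset_UNIV assms(1)] .
next
  fix r :: real assume "0 < r"
  then obtain C where C: "compact C" "\<And>x. x \<in> S \<Longrightarrow> \<exists>y\<in>C. dist y x < r/3" using approx[of "r/3"] by auto
  then obtain k where k: "finite k" "C \<subseteq> (\<Union>x\<in>k. ball x (r/3))"
    using \<open>0 < r\<close> unfolding compact_eq_totally_bounded by (metis divide_pos_pos zero_less_numeral)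
  have "closure S \<subseteq> (\<Union>z\<in>k. ball z r)"
  proof
    fix w assume "w \<in> closure S"
    then obtain x where x: "x \<in> S" "dist x w < r/3" using \<open>0 < r\<close> closure_approachable[of w S] by (metis divide_pos_pos zero_less_numeral)
    then obtain y where y: "y \<in> C" "dist y x < r/3" using C(2) by blast
    then obtain z where z: "z \<in> k" "dist z y < r/3" using k(2) by auto
    have "dist z w \<le> dist z y + dist y x + dist x w"
      by (meson add_mono_thms_linordered_semiring(3) dist_triangle order_trans)
    then show "w \<in> (\<Union>z\<in>k. ball z r)" using x y z by (auto intro!: bexI[of _ z])
  qed
  then show "\<exists>k. finite k \<and> closure S \<subseteq> (\<Union>z\<in>k. ball z r)" using k(1) by blast
qed

text \<open>Finite partial sums take values in a sum of compact sets, and the tail of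
  \<open>M\<close> makes the approximation uniform on \<open>S\<close>. This is the closure of
  compact operators under norm limits, stated without linearity.\<close>

lemma compact_closure_series_image:
  fixes T :: "nat \<Rightarrow> 'a \<Rightarrow> 'b::banach"
  assumes T: "\<And>i. compact (closure (T i ` S))"
    and bound: "\<And>i x. x \<in> S \<Longrightarrow> norm (T i x) \<le> M i" and M: "summable M"
  shows "compact (closure ((\<lambda>x. \<Sum>i. T i x) ` S))"
proof (rule compact_closure_approximation)
  show "complete (UNIV :: 'b set)" by (rule complete_UNIV)
next
  fix r :: real assume r: "0 < r"
  obtain n where n: "norm (\<Sum>i. M (i + n)) < r" using suminf_exist_split[OF r M] by blast
  have C: "compact {\<Sum>i<n. y i | y. \<forall>i<n. y i \<in> closure (T i ` S)}" for n
  proof (induction n)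
    case 0
    then show ?case by simp
  next
    case (Suc n)
    have "{\<Sum>i<Suc n. y i | y. \<forall>i<Suc n. y i \<in> closure (T i ` S)}
        = {u + v |u v. u \<in> {\<Sum>i<n. y i | y. \<forall>i<n. y i \<in> closure (T i ` S)} \<and> v \<in> closure (T n ` S)}"
      (is "?L = ?R")
    proof (intro equalityI subsetI)
      fix z assume "z \<in> ?L"
      then show "z \<in> ?R" by (fastforce simp: less_Suc_eq)
    next
      fix z assume "z \<in> ?R"
      then obtain y v where y: "\<forall>i<n. y i \<in> closure (T i ` S)" "v \<in> closure (T n ` S)"
        "z = (\<Sum>i<n. y i) + v" by auto
      then have "z = (\<Sum>i<Suc n. (y(n := v)) i)" "\<forall>i<Suc n. (y(n := v)) i \<in> closure (T i ` S)"
        by (auto simp: less_Suc_eq)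
      then show "z \<in> ?L" by blast
    qed
    then show ?case using compact_sums[OF Suc T[of n]] by simp
  qed
  have "\<exists>y\<in>{\<Sum>i<n. y i | y. \<forall>i<n. y i \<in> closure (T i ` S)}. dist y (\<Sum>i. T i x) < r" if x: "x \<in> S" for x
  proof (rule bexI)
    have M': "summable (\<lambda>i. M (i + n))" using M by (rule summable_ignore_initial_segment)
    have "summable (\<lambda>i. T i x)"
      using bound[OF x] by (intro summable_comparison_test'[OF M]) auto
    then have "(\<Sum>i. T i x) - (\<Sum>i<n. T i x) = (\<Sum>i. T (i + n) x)"
      using suminf_split_initial_segment[of "\<lambda>i. T i x" n] by simp
    then have "dist (\<Sum>i<n. T i x) (\<Sum>i. T i x) = norm (\<Sum>i. T (i + n) x)"
      by (simp add: dist_norm norm_minus_commute)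
    also have "\<dots> \<le> (\<Sum>i. M (i + n))"
      using bound[OF x] by (intro norm_suminf_le M') auto
    also have "\<dots> < r" using n by simp
    finally show "dist (\<Sum>i<n. T i x) (\<Sum>i. T i x) < r" .
    show "(\<Sum>i<n. T i x) \<in> {\<Sum>i<n. y i | y. \<forall>i<n. y i \<in> closure (T i ` S)}"
      using x closure_subset[of "T _ ` S"] by (auto intro!: exI[of _ "\<lambda>i. T i x"])
  qed
  with C[of n] show "\<exists>C. compact C \<and> (\<forall>y\<in>(\<lambda>x. \<Sum>i. T i x) ` S. \<exists>z\<in>C. dist z y < r)" by blast
qed

lemma abs_cos_diff_one_le: "\<bar>cos s - 1\<bar> \<le> \<bar>s\<bar>" for s :: real
proof -
  have "\<bar>cos s - 1\<bar> = 2 * \<bar>sin (s/2)\<bar> * \<bar>sin (s/2)\<bar>"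
    using cos_double_sin[of "s/2"] by (simp add: power2_eq_square abs_mult)
  also have "\<dots> \<le> 2 * \<bar>s/2\<bar> * 1" by (intro mult_mono abs_sin_x_le_abs_x) auto
  finally show ?thesis by simp
qed

text \<open>\<open>\<alpha> i\<close> and \<open>\<beta> i\<close> are coordinates in the plane of
  \<open>a i\<close> and \<open>b i\<close>, measured from a centre that may depend linearly on the
  point. Their norms \<open>C i\<close> may grow, as long as the angles compensate.\<close>

locale rotation_blocks = normed_space_over scale
  for scale :: "'k::{real_normed_field,heine_borel} \<Rightarrow> 'v::banach \<Rightarrow> 'v" +
  fixes a b :: "nat \<Rightarrow> 'v" and \<alpha> \<beta> :: "nat \<Rightarrow> 'v \<Rightarrow> 'k" and \<theta> C :: "nat \<Rightarrow> real"
  assumes functional_\<alpha>: "functional (\<alpha> i)" and functional_\<beta>: "functional (\<beta> i)"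
    and norm_a: "norm (a i) = 1" and norm_b: "norm (b i) = 1"
    and bound: "norm (\<alpha> i x) + norm (\<beta> i x) \<le> C i * norm x"
    and summable_angle: "summable (\<lambda>i. \<bar>\<theta> i\<bar> * C i)"
    and \<alpha>_a: "\<alpha> i (a j) = (if i = j then 1 else 0)" and \<alpha>_b: "\<alpha> i (b j) = 0"
    and \<beta>_a: "\<beta> i (a j) = 0" and \<beta>_b: "\<beta> i (b j) = (if i = j then 1 else 0)"
begin

text \<open>The displacement caused by the rotation, that is, rotation minus identity, so that the
  effects on all planes can be summed.\<close>

definition turn :: "nat \<Rightarrow> real \<Rightarrow> 'v \<Rightarrow> 'v" where
  "turn i s x = scale ((cos s - 1) *\<^sub>R \<alpha> i x - sin s *\<^sub>R \<beta> i x) (a i)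
     + scale (sin s *\<^sub>R \<alpha> i x + (cos s - 1) *\<^sub>R \<beta> i x) (b i)"

definition flow :: "real \<Rightarrow> 'v \<Rightarrow> 'v" where
  "flow t x = x + (\<Sum>i. turn i (t * \<theta> i) x)"

lemma norm_turn_coefficients_le:
  shows "norm ((cos s - 1) *\<^sub>R \<alpha> i x - sin s *\<^sub>R \<beta> i x) \<le> \<bar>s\<bar> * (norm (\<alpha> i x) + norm (\<beta> i x))"
    and "norm (sin s *\<^sub>R \<alpha> i x + (cos s - 1) *\<^sub>R \<beta> i x) \<le> \<bar>s\<bar> * (norm (\<alpha> i x) + norm (\<beta> i x))"
proof -
  have c: "norm ((cos s - 1) *\<^sub>R y) \<le> \<bar>s\<bar> * norm y" and s: "norm (sin s *\<^sub>R y) \<le> \<bar>s\<bar> * norm y" for y :: 'k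
    using abs_cos_diff_one_le[of s] abs_sin_x_le_abs_x[of s] by (auto intro: mult_right_mono)
  show "norm ((cos s - 1) *\<^sub>R \<alpha> i x - sin s *\<^sub>R \<beta> i x) \<le> \<bar>s\<bar> * (norm (\<alpha> i x) + norm (\<beta> i x))"
    unfolding distrib_left using norm_triangle_ineq4 c s by (meson add_mono order_trans)
  show "norm (sin s *\<^sub>R \<alpha> i x + (cos s - 1) *\<^sub>R \<beta> i x) \<le> \<bar>s\<bar> * (norm (\<alpha> i x) + norm (\<beta> i x))"
    unfolding distrib_left using norm_triangle_ineq c s by (metis add.commute add_mono norm_triangle_mono)
qed

lemma norm_turn_le: "norm (turn i s x) \<le> 2 * \<bar>s\<bar> * (norm (\<alpha> i x) + norm (\<beta> i x))"
proof -
  have "norm (turn i s x) \<le> norm ((cos s - 1) *\<^sub>R \<alpha> i x - sin s *\<^sub>R \<beta> i x)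
      + norm (sin s *\<^sub>R \<alpha> i x + (cos s - 1) *\<^sub>R \<beta> i x)"
    unfolding turn_def by (rule norm_triangle_le) (simp add: norm_scale norm_a norm_b)
  then show ?thesis using norm_turn_coefficients_le[of s i x] by simp
qed

lemma C_nonneg: "0 \<le> C i"
  using bound[of i "a i"] norm_a[of i] by (metis add_nonneg_nonneg mult.right_neutral norm_ge_zero order_trans)

lemma norm_turn_le_norm: "norm (turn i (t * \<theta> i) x) \<le> (2 * \<bar>t\<bar> * norm x) * (\<bar>\<theta> i\<bar> * C i)"
proof -
  have "norm (turn i (t * \<theta> i) x) \<le> 2 * \<bar>t * \<theta> i\<bar> * (C i * norm x)"
    using bound[of i x] by (intro order_trans[OF norm_turn_le] mult_left_mono) auto
  then show ?thesis by (simp add: abs_mult algebra_simps)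
qed

lemma summable_turn: "summable (\<lambda>i. turn i (t * \<theta> i) x)"
  using norm_turn_le_norm
  by (intro summable_comparison_test'[OF summable_mult[OF summable_angle]]) auto

lemma turn_add: "turn i s (x + y) = turn i s x + turn i s y"
  by (simp add: turn_def functional_add[OF functional_\<alpha>] functional_add[OF functional_\<beta>]
      scale_left_distrib scale_left_diff_distrib algebra_simps)

lemma turn_scale: "turn i s (scale c x) = scale c (turn i s x)"
  by (simp add: turn_def functional_scale[OF functional_\<alpha>] functional_scale[OF functional_\<beta>]
      scale_right_distrib algebra_simps)

text \<open>Continuity lets \<open>f\<close> pass through the series, of which a single term
  survives. Coordinates of one plane can thus be followed separately.\<close>

lemma functional_flow:
  assumes f: "bounded_linear f" and "\<And>i. i \<noteq> j \<Longrightarrow> f (turn i (t * \<theta> i) x) = 0"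
  shows "f (flow t x) = f x + f (turn j (t * \<theta> j) x)"
proof -
  have "f (\<Sum>i. turn i (t * \<theta> i) x) = (\<Sum>i. f (turn i (t * \<theta> i) x))"
    using bounded_linear.suminf[OF f summable_turn] by simp
  also have "\<dots> = (\<Sum>i\<in>{j}. f (turn i (t * \<theta> i) x))"
    using assms(2) by (intro suminf_finite) auto
  finally show ?thesis by (simp add: flow_def linear_add[OF bounded_linear.linear[OF f]])
qed

lemma \<alpha>_turn: "\<alpha> i (turn j s x) = (if i = j then (cos s - 1) *\<^sub>R \<alpha> i x - sin s *\<^sub>R \<beta> i x else 0)"
  and \<beta>_turn: "\<beta> i (turn j s x) = (if i = j then sin s *\<^sub>R \<alpha> i x + (cos s - 1) *\<^sub>R \<beta> i x else 0)"
  by (simp_all add: turn_def functional_add[OF functional_\<alpha>] functional_add[OF functional_\<beta>]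
      functional_scale[OF functional_\<alpha>] functional_scale[OF functional_\<beta>] \<alpha>_a \<alpha>_b \<beta>_a \<beta>_b)

lemma bounded_linear_\<alpha>: "bounded_linear (\<alpha> i)"
proof (rule functional_bounded_linear[OF functional_\<alpha>])
  show "norm (\<alpha> i x) \<le> norm x * C i" for x
    using bound[of i x] norm_ge_zero[of "\<beta> i x"] unfolding mult.commute[of _ "C i"] by linarith
qed

lemma bounded_linear_\<beta>: "bounded_linear (\<beta> i)"
proof (rule functional_bounded_linear[OF functional_\<beta>])
  show "norm (\<beta> i x) \<le> norm x * C i" for x
    using bound[of i x] norm_ge_zero[of "\<alpha> i x"] unfolding mult.commute[of _ "C i"] by linarith
qed

lemma \<alpha>_flow: "\<alpha> i (flow t x) = cos (t * \<theta> i) *\<^sub>R \<alpha> i x - sin (t * \<theta> i) *\<^sub>R \<beta> i x"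
  by (subst functional_flow[OF bounded_linear_\<alpha>, of i]) (auto simp: \<alpha>_turn algebra_simps)

lemma \<beta>_flow: "\<beta> i (flow t x) = sin (t * \<theta> i) *\<^sub>R \<alpha> i x + cos (t * \<theta> i) *\<^sub>R \<beta> i x"
  by (subst functional_flow[OF bounded_linear_\<beta>, of i]) (auto simp: \<beta>_turn algebra_simps)

text \<open>\<open>flow t\<close> rotates the coordinates of plane \<open>i\<close> by
  \<open>t * \<theta> i\<close>, so the addition formulas make displacements telescope. Summed over
  \<open>i\<close>, this is the group law \<open>flow_add\<close>.\<close>

lemma turn_flow: "turn i (s * \<theta> i) (flow t x) = turn i ((s + t) * \<theta> i) x - turn i (t * \<theta> i) x"
  unfolding turn_def \<alpha>_flow \<beta>_flow distrib_right cos_add sin_add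
  by (simp add: scale_left_diff_distrib scale_left_distrib algebra_simps)

lemma flow_add: "flow s (flow t x) = flow (s + t) x"
proof -
  have "(\<Sum>i. turn i (s * \<theta> i) (flow t x)) = (\<Sum>i. turn i ((s + t) * \<theta> i) x) - (\<Sum>i. turn i (t * \<theta> i) x)"
    unfolding turn_flow by (rule suminf_diff[symmetric]) (rule summable_turn)+
  then show ?thesis by (simp add: flow_def[of s] flow_def[of "s + t"]) (simp add: flow_def)
qed

lemma flow_iterate: "(flow 1 ^^ n) x = flow (real n) x"
proof (induction n)
  case 0
  then show ?case by (simp add: flow_def turn_def)
next
  case (Suc n)
  then show ?case by (simp add: flow_add)
qed

lemma linear_turns: "Vector_Spaces.linear scale scale (\<lambda>x. \<Sum>i. turn i (t * \<theta> i) x)"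
proof -
  have "vector_space scale" by unfold_locales
  then show ?thesis
    unfolding Vector_Spaces.linear_iff turn_add turn_scale
    by (auto simp: suminf_add[OF summable_turn summable_turn]
        bounded_linear.suminf[OF bounded_linear_scale_right summable_turn])
qed

lemma continuous_operator_flow: "continuous_operator scale (flow t)"
  unfolding continuous_operator_def
proof
  let ?K = "\<lambda>x. \<Sum>i. turn i (t * \<theta> i) x"
  have K: "?K (x + y) = ?K x + ?K y" "?K (scale c x) = scale c (?K x)" for x y c
    using linear_turns[of t] unfolding Vector_Spaces.linear_iff by blast+
  show "Vector_Spaces.linear scale scale (flow t)"
    using linear_turns[of t] unfolding Vector_Spaces.linear_iff flow_def K
    by (simp add: scale_right_distrib)
  have "bounded_linear ?K"
  proof (rule bounded_linear_intro)
    show "?K (x + y) = ?K x + ?K y" for x y by (rule K)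
    show "?K (r *\<^sub>R x) = r *\<^sub>R ?K x" for r x using K(2)[of "of_real r" x] by (simp only: scale_of_real)
    have "norm (?K x) \<le> (\<Sum>i. (2 * \<bar>t\<bar> * norm x) * (\<bar>\<theta> i\<bar> * C i))" for x
      using norm_turn_le_norm by (intro norm_suminf_le summable_mult summable_angle)
    then show "norm (?K x) \<le> norm x * (2 * \<bar>t\<bar> * (\<Sum>i. \<bar>\<theta> i\<bar> * C i))" for x
      unfolding suminf_mult[OF summable_angle] by (simp only: mult_ac)
  qed
  then show "continuous_on UNIV (flow t)"
    unfolding flow_def by (intro continuous_intros linear_continuous_on)
qed

text \<open>Each term has rank at most two and maps the unit ball into a sum of two compact discs;
  the norms of the terms are summable.\<close>

lemma compact_operator_turns: "compact_operator scale (\<lambda>x. \<Sum>i. turn i (t * \<theta> i) x)"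
  unfolding compact_operator_def
proof
  show "Vector_Spaces.linear scale scale (\<lambda>x. \<Sum>i. turn i (t * \<theta> i) x)" by (rule linear_turns)
  show "compact (closure ((\<lambda>x. \<Sum>i. turn i (t * \<theta> i) x) ` cball 0 1))"
  proof (rule compact_closure_series_image)
    fix i
    define r where "r = \<bar>t * \<theta> i\<bar> * C i"
    let ?D = "\<lambda>v. (\<lambda>c. scale c v) ` cball 0 r"
    have "compact (?D v)" for v
      by (intro compact_continuous_image linear_continuous_on bounded_linear_scale_left compact_cball)
    then have D: "compact {x + y |x y. x \<in> ?D (a i) \<and> y \<in> ?D (b i)}" by (intro compact_sums)
    have "turn i (t * \<theta> i) ` cball 0 1 \<subseteq> {x + y |x y. x \<in> ?D (a i) \<and> y \<in> ?D (b i)}"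
    proof
      fix y assume "y \<in> turn i (t * \<theta> i) ` cball 0 1"
      then obtain x where x: "norm x \<le> 1" "y = turn i (t * \<theta> i) x" by auto
      have "norm (\<alpha> i x) + norm (\<beta> i x) \<le> C i"
        using bound[of i x] x(1) mult_left_le[of "norm x" "C i"] C_nonneg[of i] by simp
      then have "\<bar>t * \<theta> i\<bar> * (norm (\<alpha> i x) + norm (\<beta> i x)) \<le> r"
        unfolding r_def by (intro mult_left_mono) auto
      then show "y \<in> {x + y |x y. x \<in> ?D (a i) \<and> y \<in> ?D (b i)}"
        using norm_turn_coefficients_le[of "t * \<theta> i" i x]
        unfolding x(2) turn_def by (auto intro!: exI imageI)
    qed
    then show "compact (closure (turn i (t * \<theta> i) ` cball 0 1))"
      by (metis (no_types, lifting) D closed_closure closure_minimal compact_Int_closed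
          compact_imp_closed inf.absorb_iff2)
  next
    fix i and x :: 'v assume "x \<in> cball 0 1"
    then have "(2 * \<bar>t\<bar> * norm x) * (\<bar>\<theta> i\<bar> * C i) \<le> (2 * \<bar>t\<bar> * 1) * (\<bar>\<theta> i\<bar> * C i)"
      using C_nonneg by (intro mult_right_mono mult_left_mono) auto
    then show "norm (turn i (t * \<theta> i) x) \<le> 2 * \<bar>t\<bar> * (\<bar>\<theta> i\<bar> * C i)"
      using norm_turn_le_norm[of i t x] by simp
  next
    show "summable (\<lambda>i. 2 * \<bar>t\<bar> * (\<bar>\<theta> i\<bar> * C i))" by (intro summable_mult summable_angle)
  qed
qed

end

section \<open>Escaping and recurrent points\<close>

text \<open>An escaping orbit eventually has norm at least \<open>norm x + 1\<close>, hence distance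
  at least 1 from \<open>x\<close>.\<close>

lemma A_set_Int_B_set: "A_set R \<inter> B_set R = {}"
proof -
  have False if A: "x \<in> A_set R" and B: "x \<in> B_set R" for x
  proof -
    have "\<forall>\<^sub>F t in sequentially. norm x + 1 \<le> norm ((R ^^ t) x)"
      using A by (auto simp: A_set_def filterlim_at_top)
    then have "\<forall>\<^sub>F t in sequentially. 1 \<le> ereal (norm ((R ^^ t) x - x))"
    proof eventually_elim
      case (elim t)
      then have "1 \<le> norm ((R ^^ t) x - x)" using norm_triangle_ineq2[of "(R ^^ t) x" x] by linarith
      then show ?case by simp
    qed
    then have "1 \<le> liminf (\<lambda>t. ereal (norm ((R ^^ t) x - x)))" by (rule Liminf_bounded)
    then show False using B by (simp add: B_set_def)
  qed
  then show ?thesis by blast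
qed

lemma B_setI:
  assumes "\<And>r T. 0 < r \<Longrightarrow> \<exists>t\<ge>T. norm ((R ^^ t) x - x) < r"
  shows "x \<in> B_set R"
proof -
  let ?L = "liminf (\<lambda>t. ereal (norm ((R ^^ t) x - x)))"
  have "0 \<le> ?L" by (rule Liminf_bounded) simp
  moreover have "\<not> 0 < ?L"
  proof
    assume "0 < ?L"
    then obtain r where r: "0 < ereal r" "ereal r < ?L" using ereal_dense2 by blast
    then obtain T where "\<And>t. t \<ge> T \<Longrightarrow> ereal r < ereal (norm ((R ^^ t) x - x))"
      using less_LiminfD[OF r(2)] unfolding eventually_sequentially by blast
    then show False using assms[of r T] r(1) by fastforce
  qed
  ultimately show ?thesis by (auto simp: B_set_def)
qed

text \<open>The pairs of a resolution \<open>m\<close> and a point of a finite \<open>1 / (m + 1)\<^sup>2\<close>-net of the unit ball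
  are enumerated in an arbitrary order; each resolution is used finitely often.\<close>

lemma net_enumeration:
  shows "\<exists>(lev :: nat \<Rightarrow> nat) (\<mu> :: nat \<Rightarrow> 'k::{real_normed_field,heine_borel}).
    (\<forall>i. norm (\<mu> i) \<le> 1) \<and> filterlim lev at_top sequentially \<and>
    (\<forall>m c. norm c \<le> 1 \<longrightarrow> (\<exists>i. lev i = m \<and> norm (c - \<mu> i) < 1 / (real m + 1)\<^sup>2))"
proof -
  have "\<exists>D. D \<subseteq> cball (0 :: 'k) 1 \<and> finite D \<and> cball 0 1 \<subseteq> (\<Union>d\<in>D. ball d (1 / (real m + 1)\<^sup>2))" for m :: nat
    by (rule compactE_image[OF compact_cball[of "0 :: 'k" 1], of "cball 0 1" "\<lambda>d. ball d (1 / (real m + 1)\<^sup>2)"])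
      (auto intro!: bexI simp: add_nonneg_pos)
  then obtain D :: "nat \<Rightarrow> 'k set" where D: "\<And>m. D m \<subseteq> cball 0 1" "\<And>m. finite (D m)"
      "\<And>m. cball 0 1 \<subseteq> (\<Union>d\<in>D m. ball d (1 / (real m + 1)\<^sup>2))"
    by metis
  define S where "S = Sigma UNIV D"
  have ne: "\<exists>d. d \<in> D m" for m
    using subsetD[OF D(3)[of m], of 0] by auto
  have "countable S" unfolding S_def using D(2) by (intro countable_SIGMA) (auto intro: countable_finite)
  moreover have "infinite S"
  proof
    assume "finite S"
    then have "finite (fst ` S)" by blast
    moreover have "fst ` S = UNIV" using ne by (force simp: S_def)
    ultimately show False by simp
  qed
  ultimately obtain s :: "nat \<Rightarrow> nat \<times> 'k" where s: "bij_betw s UNIV S"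
    using bij_betw_from_nat_into by blast
  have mem: "snd (s i) \<in> D (fst (s i))" for i
  proof -
    have "s i \<in> Sigma UNIV D" using bij_betwE[OF s] by (simp add: S_def)
    then show ?thesis by auto
  qed
  have "norm (snd (s i)) \<le> 1" for i using mem[of i] D(1)[of "fst (s i)"] by auto
  moreover have "filterlim (fst \<circ> s) at_top sequentially"
    unfolding filterlim_at_top
  proof
    fix Z
    \<comment> \<open>All nets are finite, so only finitely many pairs have resolution below
      \<open>Z\<close>, and \<open>s\<close> is injective.\<close>
    have "{i. \<not> Z \<le> (fst \<circ> s) i} \<subseteq> s -` (Sigma {..<Z} D)"
    proof
      fix i assume "i \<in> {i. \<not> Z \<le> (fst \<circ> s) i}"
      then show "i \<in> s -` (Sigma {..<Z} D)" using mem[of i] by (cases "s i") auto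
    qed
    moreover have "finite (s -` (Sigma {..<Z} D))"
      using D(2) s by (intro finite_vimageI finite_SigmaI) (auto simp: bij_betw_def)
    ultimately have "finite {i. \<not> Z \<le> (fst \<circ> s) i}" by (rule finite_subset)
    then show "\<forall>\<^sub>F i in sequentially. Z \<le> (fst \<circ> s) i"
      unfolding cofinite_eq_sequentially[symmetric] eventually_cofinite .
  qed
  moreover have "\<exists>i. (fst \<circ> s) i = m \<and> norm (c - (snd \<circ> s) i) < 1 / (real m + 1)\<^sup>2" if c: "norm c \<le> 1" for m c
  proof -
    obtain d where d: "d \<in> D m" "dist d c < 1 / (real m + 1)\<^sup>2" using D(3)[of m] c by auto
    then have "(m, d) \<in> S" by (simp add: S_def)
    then obtain i where "s i = (m, d)" using s unfolding bij_betw_def by (metis imageE)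
    then show ?thesis using d(2) by (auto simp: dist_norm norm_minus_commute intro!: exI[of _ i])
  qed
  ultimately show ?thesis by (intro exI[of _ "fst \<circ> s"] exI[of _ "snd \<circ> s"]) auto
qed

text \<open>With \<open>w = s / 2\<close> the expression equals
  \<open>2 * sin w * (cos w + sin w)\<close>, where the bracket is at least 1 and
  \<open>sin w \<ge> w / 3\<close>. It measures how far a half revolution has carried a point off
  its start.\<close>

lemma sin_plus_one_minus_cos_ge:
  fixes s :: real
  assumes "0 \<le> s" "s \<le> pi"
  shows "s / 3 \<le> sin s + 1 - cos s"
proof -
  define w where "w = s / 2"
  have w: "0 \<le> w" "w \<le> pi / 2" "w \<le> 2" using assms pi_less_4 by (auto simp: w_def)
  have sc: "0 \<le> sin w" "0 \<le> cos w" using w by (auto intro: sin_ge_zero cos_ge_zero)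
  have "\<bar>sin w - w\<bar> \<le> w ^ 3 / 6"
    using Maclaurin_sin_bound[of w 3] w(1) by (simp add: numeral_3_eq_3 sin_coeff_def fact_numeral)
  moreover have "w ^ 3 / 6 \<le> 2 * w / 3"
  proof -
    have "w\<^sup>2 \<le> 2\<^sup>2" using w by (intro power_mono) auto
    then have "w * w\<^sup>2 \<le> w * 4" using w(1) by (intro mult_left_mono) auto
    then show ?thesis by (simp add: power3_eq_cube power2_eq_square)
  qed
  ultimately have "w / 3 \<le> sin w" by linarith
  moreover have "1 \<le> cos w + sin w"
  proof (rule power2_le_imp_le)
    show "1\<^sup>2 \<le> (cos w + sin w)\<^sup>2" using sc by (simp add: power2_sum)
  qed (use sc in simp)
  then have "2 * sin w * 1 \<le> 2 * sin w * (cos w + sin w)" using sc by (intro mult_left_mono) auto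
  moreover have "sin s + 1 - cos s = 2 * sin w * (cos w + sin w)"
    using sin_double[of w] cos_double_sin[of w] by (simp add: w_def power2_eq_square algebra_simps)
  ultimately show ?thesis by (simp add: w_def)
qed

text \<open>For \<open>\<sigma> = sin s\<close>, \<open>\<gamma> = cos s\<close>, the difference of
  the two rotated coordinates isolates the centre \<open>h *\<^sub>R w\<close>, up to bounded
  multiples of the initial coordinates \<open>p\<close> and \<open>q\<close>.\<close>

lemma scaleR_rotation_identity:
  "((\<sigma> + 1 - \<gamma>) * h) *\<^sub>R w = p + ((\<gamma> - 1) *\<^sub>R (p - h *\<^sub>R w) - \<sigma> *\<^sub>R q)
    - (q + (\<sigma> *\<^sub>R (p - h *\<^sub>R w) + (\<gamma> - 1) *\<^sub>R q)) + ((\<sigma> + 1 - \<gamma> - 1) *\<^sub>R p + (\<sigma> + \<gamma>) *\<^sub>R q)"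
  for w p q :: "'a::real_vector"
  by (simp add: scaleR_add_left scaleR_diff_left scaleR_diff_right distrib_right left_diff_distrib)

section \<open>Choice of periods, amplitudes and centres\<close>

locale wild_system = normed_space_over scale
  for scale :: "'k::{real_normed_field,heine_borel} \<Rightarrow> 'v::banach \<Rightarrow> 'v" +
  fixes e :: "nat \<Rightarrow> 'v" and f :: "nat \<Rightarrow> 'v \<Rightarrow> 'k" and lev :: "nat \<Rightarrow> nat" and \<mu> :: "nat \<Rightarrow> 'k"
  assumes norm_e: "norm (e n) = 1" and functional_f: "functional (f n)"
    and norm_f: "norm (f n x) \<le> 3 * norm x"
    and biorthogonal: "f m (e n) = (if m = n then 1 else 0)"
    and norm_\<mu>: "norm (\<mu> i) \<le> 1" and lev: "filterlim lev at_top sequentially"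
    and net: "norm c \<le> 1 \<Longrightarrow> \<exists>i. lev i = m \<and> norm (c - \<mu> i) < 1 / (real m + 1)\<^sup>2"
begin

text \<open>The factor \<open>lev (Suc k) + 1\<close> is \<open>g (Suc k)\<close>, so that
  \<open>g i * N k / N i\<close> is exactly \<open>(1/2) ^ i\<close> for \<open>i = Suc k\<close>.
  The product form makes each period divide the next.\<close>

definition N :: "nat \<Rightarrow> nat" where "N i = (\<Prod>k<i. 2 ^ Suc k * (lev (Suc k) + 1))"

definition g :: "nat \<Rightarrow> real" where "g i = real (lev i) + 1"

definition \<phi> :: "nat \<Rightarrow> 'v \<Rightarrow> 'k" where "\<phi> i x = f 0 x - \<mu> i * f 1 x"

text \<open>Chosen so that the angle reached at time \<open>N i\<close>, multiplied by
  \<open>h i\<close>, is \<open>2 * pi * g i\<close>.\<close>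

definition h :: "nat \<Rightarrow> real" where "h i = g i * N (Suc i) / N i"

definition \<theta> :: "nat \<Rightarrow> real" where "\<theta> i = 2 * pi / N (Suc i)"

text \<open>The first coordinate relative to the centre \<open>h i *\<^sub>R \<phi> i x\<close>.
  Since \<open>\<phi> i\<close> involves only \<open>f 0\<close> and \<open>f 1\<close>, it vanishes
  on every plane and the rotations do not move the centre.\<close>

definition \<alpha> :: "nat \<Rightarrow> 'v \<Rightarrow> 'k" where "\<alpha> i x = f (2 * i + 2) x - h i *\<^sub>R \<phi> i x"

definition \<beta> :: "nat \<Rightarrow> 'v \<Rightarrow> 'k" where "\<beta> i = f (2 * i + 3)"

definition a :: "nat \<Rightarrow> 'v" where "a i = e (2 * i + 2)"

definition b :: "nat \<Rightarrow> 'v" where "b i = e (2 * i + 3)"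

definition C :: "nat \<Rightarrow> real" where "C i = 6 + 6 * h i"

lemma N_Suc: "N (Suc i) = N i * (2 ^ Suc i * (lev (Suc i) + 1))" by (simp add: N_def)

lemma N_pos: "0 < N i" by (simp add: N_def prod_pos)

lemma N_dvd: "i \<le> j \<Longrightarrow> N i dvd N j"
  unfolding N_def by (intro prod_dvd_prod_subset) auto

lemma N_mono: "i \<le> j \<Longrightarrow> N i \<le> N j"
  by (simp add: N_dvd N_pos dvd_imp_le)

lemma le_N: "i \<le> N i"
proof (induction i)
  case (Suc i)
  have "Suc i \<le> 2 * N i" using Suc N_pos[of i] by simp
  also have "\<dots> = N i * (2 * 1)" by simp
  also have "\<dots> \<le> N (Suc i)" unfolding N_Suc by (intro mult_le_mono) auto
  finally show ?case .
qed simp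

lemma g_ge: "1 \<le> g i" by (simp add: g_def)

lemma h_nonneg: "0 \<le> h i" using g_ge[of i] by (simp add: h_def)

lemma \<theta>_nonneg: "0 \<le> \<theta> i" by (simp add: \<theta>_def)

text \<open>The displacement due to the centre of plane \<open>i\<close> at time \<open>N j\<close>
  has this order: about \<open>g i\<close> for \<open>j = i\<close>, and negligible for
  \<open>j < i\<close> by \<open>N_ratio_g\<close>.\<close>

lemma angle_h: "real (N j) * \<theta> i * h i = 2 * pi * g i * (N j / N i)"
  using N_pos[of i] N_pos[of "Suc i"] by (simp add: \<theta>_def h_def)

lemma N_ratio_g: "j < i \<Longrightarrow> g i * (N j / N i) \<le> (1/2) ^ i"
proof -
  assume "j < i"
  then obtain k where i: "i = Suc k" and "N j \<le> N k" using N_mono[of j "i - 1"] by (cases i) auto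
  then have "g i * N j \<le> g i * N k" using g_ge[of i] by (intro mult_left_mono) auto
  also have "\<dots> = (1/2) ^ i * N i" by (simp add: i N_Suc g_def field_simps)
  finally show ?thesis using N_pos[of i] by (simp add: field_simps)
qed

lemma N_ratio: "j < i \<Longrightarrow> N j / N i \<le> (1/2) ^ i"
proof -
  assume "j < i"
  have "1 * (N j / N i) \<le> g i * (N j / N i)" using g_ge[of i] by (intro mult_right_mono) auto
  then show ?thesis using N_ratio_g[OF \<open>j < i\<close>] by simp
qed

lemma N_ratio_Suc: "j \<le> i \<Longrightarrow> N j / N (Suc i) \<le> (1/2) ^ i"
proof -
  assume "j \<le> i"
  then have "N j / N (Suc i) \<le> (1/2) ^ Suc i" by (intro N_ratio) simp
  also have "\<dots> \<le> (1/2 :: real) ^ i" by simp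
  finally show ?thesis .
qed

lemma bounded_linear_f: "bounded_linear (f n)"
proof (rule functional_bounded_linear[OF functional_f])
  show "norm (f n x) \<le> norm x * 3" for x using norm_f[of n x] by linarith
qed

lemma norm_\<phi>: "norm (\<phi> i x) \<le> 6 * norm x"
proof -
  have "norm (\<mu> i * f 1 x) \<le> 1 * (3 * norm x)"
    unfolding norm_mult using norm_\<mu> norm_f by (intro mult_mono) auto
  then show ?thesis unfolding \<phi>_def using norm_triangle_ineq4[of "f 0 x" "\<mu> i * f 1 x"] norm_f[of 0 x] by linarith
qed

lemma norm_\<alpha>: "norm (\<alpha> i x) \<le> 3 * norm x + h i * norm (\<phi> i x)"
  using norm_triangle_ineq4[of "f (2 * i + 2) x" "h i *\<^sub>R \<phi> i x"] norm_f[of "2 * i + 2" x] h_nonneg[of i]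
  by (simp add: \<alpha>_def)

lemma functional_\<phi>: "functional (\<phi> i)"
  unfolding functional_def \<phi>_def
  by (simp add: functional_add[OF functional_f] functional_scale[OF functional_f] algebra_simps)

sublocale rotation_blocks scale a b \<alpha> \<beta> \<theta> C
proof unfold_locales
  fix i j :: nat and x
  show "functional (\<alpha> i)"
    unfolding functional_def \<alpha>_def
    by (simp add: functional_add[OF functional_f] functional_scale[OF functional_f]
        functional_add[OF functional_\<phi>] functional_scale[OF functional_\<phi>] algebra_simps)
  show "functional (\<beta> i)" unfolding \<beta>_def by (rule functional_f)
  show "norm (a i) = 1" "norm (b i) = 1" unfolding a_def b_def by (rule norm_e)+
  have "h i * norm (\<phi> i x) \<le> h i * (6 * norm x)" using norm_\<phi> h_nonneg by (intro mult_left_mono)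
  then show "norm (\<alpha> i x) + norm (\<beta> i x) \<le> C i * norm x"
    using norm_\<alpha>[of i x] norm_f[of "2 * i + 3" x] by (simp add: C_def \<beta>_def algebra_simps)
  have parity: "2 * i + 2 \<noteq> 2 * j + 3" "2 * i + 3 \<noteq> 2 * j + 2" by presburger+
  then show "\<alpha> i (a j) = (if i = j then 1 else 0)" "\<alpha> i (b j) = 0"
    "\<beta> i (a j) = 0" "\<beta> i (b j) = (if i = j then 1 else 0)"
    unfolding \<alpha>_def \<beta>_def a_def b_def \<phi>_def biorthogonal by auto
next
  show "summable (\<lambda>i. \<bar>\<theta> i\<bar> * C i)"
  proof (rule summable_comparison_test')
    show "summable (\<lambda>i. 24 * pi * (1/2::real) ^ i)" by (intro summable_mult summable_geometric) simp
    \<comment> \<open>The angles are those at time \<open>N 0 = 1\<close>; index 0 is left out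
      because \<open>N_ratio_g\<close> needs \<open>0 < i\<close>.\<close>
    fix i :: nat assume "1 \<le> i"
    then have "N 0 / N (Suc i) \<le> (1/2) ^ i" "g i * (N 0 / N i) \<le> (1/2) ^ i"
      using N_ratio_Suc[of 0 i] N_ratio_g[of 0 i] by auto
    then have "12 * pi * (N 0 / N (Suc i)) + 12 * pi * (g i * (N 0 / N i)) \<le> 12 * pi * (1/2) ^ i + 12 * pi * (1/2) ^ i"
      by (intro add_mono mult_left_mono) auto
    moreover have "\<theta> i * h i = 2 * pi * (g i * (N 0 / N i))"
      using angle_h[of 0 i] by (simp add: N_def[of 0])
    then have "\<theta> i * C i = 12 * pi * (N 0 / N (Suc i)) + 12 * pi * (g i * (N 0 / N i))"
      unfolding C_def distrib_left mult.left_commute[of "\<theta> i"] by (simp add: N_def[of 0] \<theta>_def)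
    moreover have "norm (\<bar>\<theta> i\<bar> * C i) = \<theta> i * C i"
      using \<theta>_nonneg[of i] h_nonneg[of i] by (simp add: C_def abs_mult)
    ultimately show "norm (\<bar>\<theta> i\<bar> * C i) \<le> 24 * pi * (1/2) ^ i" by linarith
  qed
qed

section \<open>Return times and recurrent points\<close>

lemma turn_return: "i < j \<Longrightarrow> turn i (real (N j) * \<theta> i) x = 0"
proof -
  assume "i < j"
  \<comment> \<open>The period \<open>N (Suc i)\<close> divides \<open>N j\<close>, so plane
    \<open>i\<close> has made \<open>k\<close> full revolutions.\<close>
  then obtain k where k: "N j = N (Suc i) * k" using N_dvd[of "Suc i" j] by auto
  have "real (N j) * \<theta> i = 2 * pi * real k" using N_pos[of "Suc i"] by (simp add: k \<theta>_def)
  then have "cos (real (N j) * \<theta> i) = 1" "sin (real (N j) * \<theta> i) = 0"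
    by (metis cos_2npi mult.assoc mult.commute mult_2, metis sin_2npi mult.assoc mult.commute mult_2)
  then show ?thesis by (simp add: turn_def)
qed

text \<open>The angle is multiplied by the size of the coordinates. The part without
  \<open>h i\<close> decays geometrically; so does the part with \<open>h i\<close> when
  \<open>j < i\<close>, while \<open>i = j\<close> leaves the term with \<open>g j\<close>.\<close>

lemma norm_turn_tail:
  assumes "j \<le> i"
  shows "norm (turn i (real (N j) * \<theta> i) x)
    \<le> 48 * pi * norm x * (1/2) ^ i + (if i = j then 4 * pi * g j * norm (\<phi> j x) else 0)"
proof -
  let ?t = "real (N j) * \<theta> i"
  have "0 \<le> ?t" using \<theta>_nonneg by simp
  have "norm (turn i ?t x) \<le> 2 * ?t * (norm (\<alpha> i x) + norm (\<beta> i x))"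
    using norm_turn_le[of i ?t x] \<open>0 \<le> ?t\<close> by simp
  also have "\<dots> \<le> 2 * ?t * (6 * norm x + h i * norm (\<phi> i x))"
    using norm_\<alpha>[of i x] norm_f[of "2 * i + 3" x, folded \<beta>_def] \<open>0 \<le> ?t\<close> by (intro mult_left_mono) auto
  also have "\<dots> = 24 * pi * norm x * (N j / N (Suc i)) + 2 * (?t * h i) * norm (\<phi> i x)"
    by (simp add: \<theta>_def algebra_simps)
  also have "\<dots> = 24 * pi * norm x * (N j / N (Suc i)) + 4 * pi * (g i * (N j / N i)) * norm (\<phi> i x)"
    by (simp add: angle_h)
  also have "\<dots> \<le> 24 * pi * norm x * (1/2) ^ i + 4 * pi * (g i * (N j / N i)) * norm (\<phi> i x)"
    using N_ratio_Suc[OF assms] by (intro add_right_mono mult_left_mono) auto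
  finally have *: "norm (turn i ?t x) \<le> \<dots>" .
  show ?thesis
  proof (cases "i = j")
    case True
    have "0 \<le> 24 * pi * norm x * (1/2) ^ j" by simp
    moreover have "g j * (N j / N j) = g j" using N_pos[of j] by simp
    ultimately show ?thesis using * unfolding True by (simp only: if_True refl)
  next
    case False
    then have "g i * (N j / N i) \<le> (1/2) ^ i" using assms by (intro N_ratio_g) simp
    then have "4 * pi * (g i * (N j / N i)) * norm (\<phi> i x) \<le> 4 * pi * (1/2) ^ i * (6 * norm x)"
      using norm_\<phi>[of i x] g_ge[of i] by (intro mult_mono mult_left_mono) auto
    then show ?thesis using * False by (simp add: algebra_simps)
  qed
qed

text \<open>Planes before \<open>j\<close> drop out by \<open>turn_return\<close>; summing the
  geometric bounds from \<open>j\<close> onwards doubles 48 to 96.\<close>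

lemma return_estimate:
  "norm (flow (N j) x - x) \<le> 96 * pi * norm x * (1/2) ^ j + 4 * pi * g j * norm (\<phi> j x)"
proof -
  let ?T = "\<lambda>i. turn i (real (N j) * \<theta> i) x"
  let ?q = "48 * pi * norm x * (1/2) ^ j"
  let ?M = "\<lambda>i. ?q * (1/2) ^ i + (if i = 0 then 4 * pi * g j * norm (\<phi> j x) else 0)"
  have M: "?M sums (?q * 2 + 4 * pi * g j * norm (\<phi> j x))"
    using sums_add[OF sums_mult[OF geometric_sums[of "1/2 :: real"], of ?q]
      sums_If_finite[of "\<lambda>i. i = 0" "\<lambda>_. 4 * pi * g j * norm (\<phi> j x)"]] by simp
  have "flow (N j) x - x = (\<Sum>i. ?T i)" by (simp add: flow_def)
  also have "\<dots> = (\<Sum>i. ?T (i + j))"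
    using suminf_split_initial_segment[OF summable_turn, of "N j" x j] turn_return by simp
  finally have shift: "flow (N j) x - x = (\<Sum>i. ?T (i + j))" .
  have "norm (flow (N j) x - x) \<le> (\<Sum>i. ?M i)"
    unfolding shift
  proof (rule norm_suminf_le)
    show "norm (?T (i + j)) \<le> ?M i" for i
      using norm_turn_tail[of j "i + j" x] by (simp add: power_add mult_ac)
    show "summable ?M" using M by (rule sums_summable)
  qed
  then have "norm (flow (N j) x - x) \<le> ?q * 2 + 4 * pi * g j * norm (\<phi> j x)"
    unfolding sums_unique[OF M, symmetric] .
  then show ?thesis by simp
qed

text \<open>Write \<open>f 0 x = c * f 1 x\<close> with \<open>norm c \<le> 1\<close> and return at
  times \<open>N j\<close> for which \<open>\<mu> j\<close> is close to \<open>c\<close>. The net is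
  finer than \<open>g j\<close> is large: \<open>g j * norm (\<phi> j x)\<close> is at most
  \<open>norm (f 1 x) / (m + 1)\<close>.\<close>

lemma recurrent:
  assumes x: "norm (f 0 x) \<le> norm (f 1 x)"
  shows "x \<in> B_set (flow 1)"
proof (rule B_setI)
  fix r :: real and T :: nat assume r: "0 < r"
  obtain c where c: "norm c \<le> 1" "f 0 x = c * f 1 x"
  proof (cases "f 1 x = 0")
    case True
    then show ?thesis using x that[of 0] by simp
  next
    case False
    then show ?thesis using x that[of "f 0 x / f 1 x"] by (simp add: norm_divide)
  qed
  have "(\<lambda>j. 96 * pi * norm x * (1/2) ^ j) \<longlonglongrightarrow> 96 * pi * norm x * 0"
    by (intro tendsto_mult tendsto_const LIMSEQ_power_zero) simp
  then have "\<forall>\<^sub>F j in sequentially. 96 * pi * norm x * (1/2) ^ j < r / 2"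
    using r by (intro order_tendstoD) auto
  then obtain J where J: "\<And>j. J \<le> j \<Longrightarrow> 96 * pi * norm x * (1/2) ^ j < r / 2"
    unfolding eventually_sequentially by blast
  obtain m0 :: nat where m0: "4 * pi * norm (f 1 x) / (r / 2) < m0" using reals_Archimedean2 by blast
  \<comment> \<open>The sum makes \<open>m\<close> exceed every level used before index
    \<open>J + T\<close>, forcing the chosen \<open>j\<close> to be late.\<close>
  define m where "m = m0 + (\<Sum>i<J + T. lev i) + 1"
  obtain j where j: "lev j = m" "norm (c - \<mu> j) < 1 / (real m + 1)\<^sup>2" using net[OF c(1)] by blast
  have "J + T \<le> j"
  proof (rule ccontr)
    assume "\<not> J + T \<le> j"
    then have "lev j \<le> (\<Sum>i<J + T. lev i)" by (intro member_le_sum) auto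
    then show False using j(1) by (simp add: m_def)
  qed
  have "norm (\<phi> j x) = norm (c - \<mu> j) * norm (f 1 x)"
    by (simp add: \<phi>_def c(2) flip: norm_mult left_diff_distrib)
  also have "\<dots> \<le> 1 / (real m + 1)\<^sup>2 * norm (f 1 x)" using j(2) by (intro mult_right_mono) auto
  finally have "4 * pi * g j * norm (\<phi> j x) \<le> 4 * pi * g j * (1 / (real m + 1)\<^sup>2 * norm (f 1 x))"
    using g_ge[of j] by (intro mult_left_mono) auto
  also have "\<dots> = 4 * pi * norm (f 1 x) / (real m + 1)"
    by (simp add: g_def j(1) power2_eq_square)
  also have "\<dots> < r / 2"
  proof -
    have "4 * pi * norm (f 1 x) < m0 * (r / 2)" using m0 r by (simp add: field_simps)
    also have "m0 \<le> m" by (simp add: m_def)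
    then have "m0 * (r / 2) \<le> (real m + 1) * (r / 2)" using r by (intro mult_right_mono) auto
    finally show ?thesis by (simp add: field_simps add_nonneg_pos)
  qed
  finally have "norm (flow (N j) x - x) < r"
    using return_estimate[of j x] J[of j] \<open>J + T \<le> j\<close> by simp
  then have "norm ((flow 1 ^^ N j) x - x) < r" by (simp add: flow_iterate)
  moreover have "T \<le> N j" using le_N[of j] \<open>J + T \<le> j\<close> by simp
  ultimately show "\<exists>t\<ge>T. norm ((flow 1 ^^ t) x - x) < r" by blast
qed

text \<open>In this window plane \<open>i\<close> has turned by an angle \<open>s\<close> between
  \<open>pi * N i / N (Suc i)\<close> and \<open>pi\<close>, enough to reveal the large centre in
  the difference of its two coordinates.\<close>

lemma window_estimate:
  assumes t: "real (N i) \<le> 2 * t" "2 * t \<le> real (N (Suc i))"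
  shows "g i * norm (\<phi> i x) \<le> 24 * norm x + 6 * norm (flow t x)"
proof -
  define s where "s = t * \<theta> i"
  define \<kappa> where "\<kappa> = sin s + 1 - cos s"
  let ?p = "f (2 * i + 2)" and ?q = "f (2 * i + 3)"
  have "pi * (N i / N (Suc i)) \<le> s" "s \<le> pi"
    using t N_pos[of "Suc i"] by (auto simp: s_def \<theta>_def field_simps)
  \<comment> \<open>The factor 3 cancels the 1/3 of \<open>sin_plus_one_minus_cos_ge\<close>, giving
    \<open>\<kappa> \<ge> N i / N (Suc i)\<close> and hence
    \<open>\<kappa> * h i \<ge> g i\<close>.\<close>
  moreover have "3 * (N i / N (Suc i)) \<le> pi * (N i / N (Suc i))"
    using pi_gt3 by (intro mult_right_mono) auto
  moreover have "0 \<le> 3 * (N i / N (Suc i))" by simp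
  ultimately have s: "0 \<le> s" "s \<le> pi" "3 * (N i / N (Suc i)) \<le> s" by linarith+
  have "N i / N (Suc i) \<le> \<kappa>"
    using sin_plus_one_minus_cos_ge[OF s(1,2)] s(3) by (simp add: \<kappa>_def)
  then have "N i / N (Suc i) * h i \<le> \<kappa> * h i" using h_nonneg by (rule mult_right_mono)
  moreover have "N i / N (Suc i) * h i = g i" using N_pos[of i] N_pos[of "Suc i"] by (simp add: h_def)
  ultimately have "g i * norm (\<phi> i x) \<le> \<kappa> * h i * norm (\<phi> i x)" by (intro mult_right_mono) auto
  \<comment> \<open>The raw coordinates \<open>?p\<close> and \<open>?q\<close> also see only plane
    \<open>i\<close>, but unlike \<open>\<alpha> i\<close> they are bounded by 3 uniformly in
    \<open>i\<close>, so no factor \<open>h i\<close> is lost.\<close>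
  have p_turn: "?p (turn j r x) = (if j = i then (cos r - 1) *\<^sub>R \<alpha> i x - sin r *\<^sub>R \<beta> i x else 0)"
    and q_turn: "?q (turn j r x) = (if j = i then sin r *\<^sub>R \<alpha> i x + (cos r - 1) *\<^sub>R \<beta> i x else 0)" for j r
  proof -
    have "2 * i + 2 \<noteq> 2 * j + 3" "2 * i + 3 \<noteq> 2 * j + 2" by presburger+
    then show "?p (turn j r x) = (if j = i then (cos r - 1) *\<^sub>R \<alpha> i x - sin r *\<^sub>R \<beta> i x else 0)"
      "?q (turn j r x) = (if j = i then sin r *\<^sub>R \<alpha> i x + (cos r - 1) *\<^sub>R \<beta> i x else 0)"
      unfolding turn_def functional_add[OF functional_f] functional_scale[OF functional_f] a_def b_def biorthogonal
      by auto
  qed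
  have flow_p: "?p (flow t x) = ?p x + ((cos s - 1) *\<^sub>R \<alpha> i x - sin s *\<^sub>R ?q x)"
    by (subst functional_flow[OF bounded_linear_f, of i]) (simp_all only: p_turn s_def \<beta>_def refl if_True if_False)
  have flow_q: "?q (flow t x) = ?q x + (sin s *\<^sub>R \<alpha> i x + (cos s - 1) *\<^sub>R ?q x)"
    by (subst functional_flow[OF bounded_linear_f, of i]) (simp_all only: q_turn s_def \<beta>_def refl if_True if_False)
  have rot: "(\<kappa> * h i) *\<^sub>R \<phi> i x = ?p (flow t x) - ?q (flow t x) + ((\<kappa> - 1) *\<^sub>R ?p x + (sin s + cos s) *\<^sub>R ?q x)"
    unfolding flow_p flow_q \<alpha>_def \<kappa>_def by (rule scaleR_rotation_identity)
  have "norm ((\<kappa> * h i) *\<^sub>R \<phi> i x) \<le> norm (?p (flow t x)) + norm (?q (flow t x)) + (\<bar>\<kappa> - 1\<bar> * norm (?p x) + \<bar>sin s + cos s\<bar> * norm (?q x))"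
    unfolding rot
    by (rule order_trans[OF norm_triangle_ineq add_mono[OF norm_triangle_ineq4 order_trans[OF norm_triangle_ineq]]])
      simp
  also have "\<dots> \<le> 3 * norm (flow t x) + 3 * norm (flow t x) + (2 * (3 * norm x) + 2 * (3 * norm x))"
  proof (intro add_mono mult_mono norm_f)
    show "\<bar>\<kappa> - 1\<bar> \<le> 2" "\<bar>sin s + cos s\<bar> \<le> 2"
      using abs_sin_le_one[of s] abs_cos_le_one[of s] unfolding \<kappa>_def by linarith+
  qed auto
  finally have "norm ((\<kappa> * h i) *\<^sub>R \<phi> i x) \<le> 12 * norm x + 6 * norm (flow t x)" by simp
  moreover have "\<kappa> * h i * norm (\<phi> i x) \<le> norm ((\<kappa> * h i) *\<^sub>R \<phi> i x)"
    by (simp add: mult_right_mono)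
  ultimately show ?thesis using \<open>g i * norm (\<phi> i x) \<le> \<kappa> * h i * norm (\<phi> i x)\<close> norm_ge_zero[of x] by linarith
qed

text \<open>As \<open>norm (\<mu> i) \<le> 1\<close>, all \<open>\<phi> i x\<close> are bounded away
  from 0 by the same \<open>d\<close>. The windows cover all late times, and \<open>g\<close> tends
  to infinity.\<close>

lemma escaping:
  assumes x: "norm (f 1 x) < norm (f 0 x)"
  shows "x \<in> A_set (flow 1)"
proof -
  define d where "d = norm (f 0 x) - norm (f 1 x)"
  have d: "0 < d" using x by (simp add: d_def)
  have \<phi>_ge: "d \<le> norm (\<phi> i x)" for i
  proof -
    have "norm (\<mu> i * f 1 x) \<le> 1 * norm (f 1 x)" unfolding norm_mult using norm_\<mu> by (intro mult_right_mono) auto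
    then show ?thesis using norm_triangle_ineq2[of "f 0 x" "\<mu> i * f 1 x"] by (simp add: \<phi>_def d_def)
  qed
  have "\<forall>\<^sub>F t in sequentially. Z \<le> norm ((flow 1 ^^ t) x)" for Z :: real
  proof -
    obtain m :: nat where m: "(24 * norm x + 6 * Z) / d < m" using reals_Archimedean2 by blast
    obtain I where I: "\<And>i. I \<le> i \<Longrightarrow> m \<le> lev i"
      using lev unfolding filterlim_at_top eventually_sequentially by blast
    have "Z \<le> norm ((flow 1 ^^ t) x)" if t: "N I \<le> t" for t
    proof -
      \<comment> \<open>The least such \<open>i\<close> is the window containing
        \<open>t\<close>.\<close>
      define P where "P = (\<lambda>i. 2 * t \<le> N (Suc i))"
      define i where "i = (LEAST i. P i)"
      have "P (2 * t)" using le_N[of "Suc (2 * t)"] by (simp add: P_def)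
      then have upper: "2 * t \<le> N (Suc i)" unfolding i_def P_def[symmetric] by (metis LeastI P_def)
      have lower: "N i \<le> 2 * t"
      proof (cases i)
        \<comment> \<open>In the first window the lower end is \<open>N 0 = 1\<close>, and
          \<open>t\<close> is at least \<open>N I > 0\<close>.\<close>
        case 0
        then show ?thesis using t N_pos[of I] by (simp add: N_def[of 0])
      next
        case (Suc k)
        then have "\<not> P k" using not_less_Least[of k P] by (simp add: i_def)
        then show ?thesis by (simp add: P_def Suc)
      qed
      \<comment> \<open>An earlier window would give \<open>2 * t \<le> N I \<le> t\<close>,
        impossible for positive \<open>t\<close>.\<close>
      have "I \<le> i"
      proof (rule ccontr)
        assume "\<not> I \<le> i"
        then have "2 * t \<le> N I" using upper N_mono[of "Suc i" I] by simp
        then show False using t N_pos[of I] by simp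
      qed
      then have "m * d \<le> g i * norm (\<phi> i x)" using I[of i] \<phi>_ge[of i] d by (intro mult_mono) (auto simp: g_def)
      also have "real (N i) \<le> real (2 * t)" "real (2 * t) \<le> real (N (Suc i))"
        using lower upper by (simp_all only: of_nat_le_iff)
      then have "g i * norm (\<phi> i x) \<le> 24 * norm x + 6 * norm (flow t x)"
        by (intro window_estimate) simp_all
      finally have "m * d \<le> 24 * norm x + 6 * norm (flow t x)" .
      moreover have "24 * norm x + 6 * Z < m * d" using m d by (simp add: field_simps)
      ultimately show ?thesis by (simp add: flow_iterate)
    qed
    then show ?thesis unfolding eventually_sequentially by blast
  qed
  then show ?thesis by (simp add: A_set_def filterlim_at_top)
qed

text \<open>The strict inequalities between \<open>norm (f 0 x)\<close> and
  \<open>norm (f 1 x)\<close> define open cones, which contain \<open>e 0\<close> and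
  \<open>e 1\<close>.\<close>

lemma interior_A_set: "interior (A_set (flow 1)) \<noteq> {}" and interior_B_set: "interior (B_set (flow 1)) \<noteq> {}"
proof -
  have cont: "continuous_on UNIV (\<lambda>x. norm (f n x))" for n
    by (intro continuous_on_norm linear_continuous_on bounded_linear_f)
  have "open {x. norm (f 1 x) < norm (f 0 x)}" "open {x. norm (f 0 x) < norm (f 1 x)}"
    by (intro open_Collect_less cont)+
  then have sub: "{x. norm (f 1 x) < norm (f 0 x)} \<subseteq> interior (A_set (flow 1))"
    "{x. norm (f 0 x) < norm (f 1 x)} \<subseteq> interior (B_set (flow 1))"
    by (intro interior_maximal; blast intro: escaping recurrent less_imp_le)+
  have mem: "e 0 \<in> {x. norm (f 1 x) < norm (f 0 x)}" "e 1 \<in> {x. norm (f 0 x) < norm (f 1 x)}"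
    by (simp_all add: biorthogonal del: One_nat_def)
  show "interior (A_set (flow 1)) \<noteq> {}" using subsetD[OF sub(1) mem(1)] by blast
  show "interior (B_set (flow 1)) \<noteq> {}" using subsetD[OF sub(2) mem(2)] by blast
qed

lemma A_set_Un_B_set: "A_set (flow 1) \<union> B_set (flow 1) = UNIV"
proof -
  have "x \<in> A_set (flow 1) \<union> B_set (flow 1)" for x
    by (cases "norm (f 0 x) \<le> norm (f 1 x)") (auto intro: escaping recurrent)
  then show ?thesis by blast
qed

end

section \<open>Assembly of the operator and the two scalar fields\<close>

theorem (in hahn_banach_space) wild_operator_exists:
  assumes "subspace V" and "infinite_dimensional scale V"
  shows "\<exists>R. continuous_operator scale R \<and>
      (interior (A_set R) \<noteq> {} \<and> interior (B_set R) \<noteq> {} \<and> A_set R \<union> B_set R = UNIV \<and> A_set R \<inter> B_set R = {}) \<and>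
      (\<exists>K. compact_operator scale K \<and> R = (\<lambda>x. x + K x))"
proof -
  obtain e :: "nat \<Rightarrow> 'v" and f :: "nat \<Rightarrow> 'v \<Rightarrow> 'k" where
      ef: "\<And>n. norm (e n) = 1" "\<And>n. functional (f n)" "\<And>n x. norm (f n x) \<le> 3 * norm x"
      "\<And>i j. f i (e j) = (if i = j then 1 else 0)"
    using bounded_biorthogonal_sequence[OF assms] by blast
  obtain lev :: "nat \<Rightarrow> nat" and \<mu> :: "nat \<Rightarrow> 'k" where
      \<mu>: "\<And>i. norm (\<mu> i) \<le> 1" "filterlim lev at_top sequentially"
      "\<And>m c. norm c \<le> 1 \<Longrightarrow> \<exists>i. lev i = m \<and> norm (c - \<mu> i) < 1 / (real m + 1)\<^sup>2"
    using net_enumeration by blast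
  interpret wild_system scale e f lev \<mu>
    by (intro wild_system.intro normed_space_over_axioms wild_system_axioms.intro ef \<mu>)
  show ?thesis
    \<comment> \<open>The factor 1 in the angle makes \<open>K\<close> literally the series of
      \<open>flow_def\<close> at time 1.\<close>
    by (intro exI[of _ "flow 1"] conjI exI[of _ "\<lambda>x. \<Sum>i. turn i (1 * \<theta> i) x"] ext flow_def
        continuous_operator_flow compact_operator_turns interior_A_set interior_B_set A_set_Un_B_set A_set_Int_B_set)
qed

theorem corollary1p2:
  fixes scaleC :: "complex \<Rightarrow> 'b::banach \<Rightarrow> 'b"
  shows
    "((\<exists>X0 :: 'a::banach set. closed_subspace scaleR X0 \<and> separable_space (top_of_set X0) \<and>
          infinite_dimensional scaleR X0 \<and> complemented scaleR X0)
      \<longrightarrow> (\<exists>R :: 'a \<Rightarrow> 'a. continuous_operator scaleR R \<and>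
            (interior (A_set R) \<noteq> {} \<and> interior (B_set R) \<noteq> {} \<and>
             A_set R \<union> B_set R = UNIV \<and> A_set R \<inter> B_set R = {}) \<and>
            (\<exists>K. compact_operator scaleR K \<and> R = (\<lambda>x. x + K x))))
     \<and>
     (normed_space_over scaleC \<longrightarrow>
      (\<exists>X0. closed_subspace scaleC X0 \<and> separable_space (top_of_set X0) \<and>
          infinite_dimensional scaleC X0 \<and> complemented scaleC X0)
      \<longrightarrow> (\<exists>R. continuous_operator scaleC R \<and>
            (interior (A_set R) \<noteq> {} \<and> interior (B_set R) \<noteq> {} \<and>
             A_set R \<union> B_set R = UNIV \<and> A_set R \<inter> B_set R = {}) \<and>
            (\<exists>K. compact_operator scaleC K \<and> R = (\<lambda>x. x + K x))))"
proof (intro conjI impI)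
  assume "\<exists>X0 :: 'a set. closed_subspace scaleR X0 \<and> separable_space (top_of_set X0) \<and>
    infinite_dimensional scaleR X0 \<and> complemented scaleR X0"
  then obtain X0 :: "'a set" where "module.subspace scaleR X0" "infinite_dimensional scaleR X0"
    unfolding closed_subspace_def by (elim exE conjE)
  then show "\<exists>R :: 'a \<Rightarrow> 'a. continuous_operator scaleR R \<and>
      (interior (A_set R) \<noteq> {} \<and> interior (B_set R) \<noteq> {} \<and>
       A_set R \<union> B_set R = UNIV \<and> A_set R \<inter> B_set R = {}) \<and>
      (\<exists>K. compact_operator scaleR K \<and> R = (\<lambda>x. x + K x))"
    by (rule hahn_banach_space.wild_operator_exists[OF hahn_banach_space_real])
next
  assume C: "normed_space_over scaleC"
  assume "\<exists>X0. closed_subspace scaleC X0 \<and> separable_space (top_of_set X0) \<and>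
    infinite_dimensional scaleC X0 \<and> complemented scaleC X0"
  then obtain X0 where "module.subspace scaleC X0" "infinite_dimensional scaleC X0"
    unfolding closed_subspace_def by (elim exE conjE)
  then show "\<exists>R. continuous_operator scaleC R \<and>
      (interior (A_set R) \<noteq> {} \<and> interior (B_set R) \<noteq> {} \<and>
       A_set R \<union> B_set R = UNIV \<and> A_set R \<inter> B_set R = {}) \<and>
      (\<exists>K. compact_operator scaleC K \<and> R = (\<lambda>x. x + K x))"
    by (rule hahn_banach_space.wild_operator_exists[OF hahn_banach_space_complex[OF C]])
qed

end
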